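(* Let $g\ge2$. The smallest $\rho$ such that $\mathfrak B^{\mathrm{min}}_g\subseteq\rho\,\mathfrak B^{\mathrm{spin}}_g$ is $\rho=g$. In particular, the following estimate $g$ is sharp, i.e. $g$ cannot be replaced by a smaller number: whenever $A$ is a $g$-tuple of symmetric matrices with $\mathcal D_{L_A}$ bounded and such that $C\in\mathcal D_{L_A}$, $1\le j\le g$ imply $(0,\dots,0,C_j,0,\dots,0)\in\mathcal D_{L_A}$ ($C_j$ in position $j$), every $C\in\mathcal D_{L_A}(n)$ dilates to $gT$ for some commuting tuple $T\in\mathcal D_{L_A}(gn)$.
   Context: $\mathbb S_n$ is the set of real symmetric $n\times n$ matrices. For a $g$-tuple $A$ of symmetric matrices, $\mathcal D_{L_A}(n)=\{X\in\mathbb S_n^g:I-\sum_jA_j\otimes X_j\succeq0\}$ and $\mathcal D_{L_A}=(\mathcal D_{L_A}(n))_n$. $X\in\mathbb S_n^g$ dilates to a tuple $T$ on a Hilbert space $\mathcal H$ if there is an isometry $V:\mathbb R^n\to\mathcal H$ with $X_j=V^*T_jV$ for all $j$. Inclusions are between sets of $g$-tuples of symmetric matrices of all sizes (levelwise). Min ball $\mathfrak B^{\mathrm{min}}_g$: all $g$-tuples $X=(X_1,\dots,X_g)$ of symmetric matrices (of the same size) with $\sum_{j=1}^gx_jX_j\preceq I$ for all unit vectors $x\in\mathbb R^g$. Spin ball $\mathfrak B^{\mathrm{spin}}_g$: all $g$-tuples $X$ of symmetric matrices with $I-\sum_{j=1}^gP_j\otimes X_j\succeq0$, where $P=(P_1,\dots,P_g)$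 is the following tuple of symmetric $2^{g-1}\times2^{g-1}$ matrices. With $\sigma_0=I_2$, $\sigma_1=\begin{pmatrix}1&0\\0&-1\end{pmatrix}$, $\sigma_2=\begin{pmatrix}0&1\\1&0\end{pmatrix}$, each $P_j$ is a $(g-1)$-fold tensor product: $P_1=\sigma_1\otimes\sigma_0\otimes\cdots\otimes\sigma_0$; for $2\le j\le g-1$, $P_j=\sigma_2\otimes\cdots\otimes\sigma_2\otimes\sigma_1\otimes\sigma_0\otimes\cdots\otimes\sigma_0$ with $\sigma_1$ in the $j$-th factor (so $\sigma_2$ appears $j-1$ times and $\sigma_0$ appears $g-j-1$ times); $P_g=\sigma_2\otimes\cdots\otimes\sigma_2$. (They satisfy $P_jP_k+P_kP_j=2\delta_{jk}I$.) *)

theory Defs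
  imports Complex_Main "Jordan_Normal_Form.Matrix"
begin

text \<open>
  A tuple of matrices is a list, so the paper's \<open>X\<^sub>j\<close> (\<open>1 \<le> j \<le> g\<close>) is \<open>X ! (j - 1)\<close>.
  A set of tuples of all sizes is a family of sets indexed by the size \<open>n\<close>; only
  the sizes \<open>n \<ge> 1\<close> are meant.
\<close>

definition sym_tuples :: "nat \<Rightarrow> nat \<Rightarrow> real mat list set" where
  "sym_tuples g n =
     {X. length X = g \<and> (\<forall>M \<in> set X. M \<in> carrier_mat n n \<and> transpose_mat M = M)}"

definition psd :: "real mat \<Rightarrow> bool" where
  "psd M \<longleftrightarrow> transpose_mat M = M \<and> (\<forall>v \<in> carrier_vec (dim_row M). 0 \<le> v \<bullet> (M *\<^sub>v v))"

definition kron :: "real mat \<Rightarrow> real mat \<Rightarrow> real mat" where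
  "kron A B = mat (dim_row A * dim_row B) (dim_col A * dim_col B)
     (\<lambda>(i, j). A $$ (i div dim_row B, j div dim_col B) * B $$ (i mod dim_row B, j mod dim_col B))"

definition msum :: "nat \<Rightarrow> real mat list \<Rightarrow> real mat" where
  "msum n Ms = foldr (+) Ms (0\<^sub>m n n)"

definition scale_tuple :: "real \<Rightarrow> real mat list \<Rightarrow> real mat list" where
  "scale_tuple r X = map (\<lambda>M. r \<cdot>\<^sub>m M) X"

definition commuting_tuple :: "real mat list \<Rightarrow> bool" where
  "commuting_tuple T \<longleftrightarrow> (\<forall>S \<in> set T. \<forall>R \<in> set T. S * R = R * S)"

definition levelwise_subset :: "(nat \<Rightarrow> real mat list set) \<Rightarrow> (nat \<Rightarrow> real mat list set) \<Rightarrow> bool" where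
  "levelwise_subset K L \<longleftrightarrow> (\<forall>n \<ge> 1. K n \<subseteq> L n)"

text \<open>Here \<open>A\<close> is a tuple of symmetric \<open>d \<times> d\<close> matrices.\<close>

definition free_spectrahedron :: "nat \<Rightarrow> real mat list \<Rightarrow> nat \<Rightarrow> real mat list set" where
  "free_spectrahedron d A n =
     {X \<in> sym_tuples (length A) n.
        psd (1\<^sub>m (d * n) - msum (d * n) (map (\<lambda>j. kron (A ! j) (X ! j)) [0..<length A]))}"

text \<open>
  Boundedness is with respect to the operator norm, uniformly over all sizes. The norm bound is
  spelled out on vectors: \<open>(M *\<^sub>v v) \<bullet> (M *\<^sub>v v)\<close> is the squared Euclidean norm of \<open>M v\<close>.
\<close>

definition bounded_levels :: "(nat \<Rightarrow> real mat list set) \<Rightarrow> bool" where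
  "bounded_levels K \<longleftrightarrow>
     (\<exists>r. \<forall>n \<ge> 1. \<forall>X \<in> K n. \<forall>M \<in> set X. \<forall>v \<in> carrier_vec n.
        sqrt ((M *\<^sub>v v) \<bullet> (M *\<^sub>v v)) \<le> r * sqrt (v \<bullet> v))"

definition coordinate_tuple :: "nat \<Rightarrow> nat \<Rightarrow> nat \<Rightarrow> real mat \<Rightarrow> real mat list" where
  "coordinate_tuple g n j M = (replicate g (0\<^sub>m n n))[j := M]"

definition coordinate_closed :: "nat \<Rightarrow> (nat \<Rightarrow> real mat list set) \<Rightarrow> bool" where
  "coordinate_closed g K \<longleftrightarrow>
     (\<forall>n \<ge> 1. \<forall>C \<in> K n. \<forall>j < g. coordinate_tuple g n j (C ! j) \<in> K n)"

text \<open>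
  The Hilbert space to which a tuple is dilated is \<open>\<real>\<^sup>N\<close> here, since \<open>T\<close> is always a tuple of
  \<open>N \<times> N\<close> matrices; \<open>V\<close> is an isometry from \<open>\<real>\<^sup>n\<close> to \<open>\<real>\<^sup>N\<close>.
\<close>

definition dilates_to :: "nat \<Rightarrow> real mat list \<Rightarrow> nat \<Rightarrow> real mat list \<Rightarrow> bool" where
  "dilates_to n X N T \<longleftrightarrow>
     length X = length T \<and>
     (\<exists>V \<in> carrier_mat N n. transpose_mat V * V = 1\<^sub>m n \<and>
        (\<forall>j < length X. X ! j = transpose_mat V * T ! j * V))"

definition min_ball :: "nat \<Rightarrow> nat \<Rightarrow> real mat list set" where
  "min_ball g n =
     {X \<in> sym_tuples g n. \<forall>x \<in> carrier_vec g. x \<bullet> x = 1 \<longrightarrow>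
        psd (1\<^sub>m n - msum n (map (\<lambda>j. x $ j \<cdot>\<^sub>m X ! j) [0..<g]))}"

definition sigma0 :: "real mat" where
  "sigma0 = 1\<^sub>m 2"

definition sigma1 :: "real mat" where
  "sigma1 = mat_of_rows_list 2 [[1, 0], [0, -1]]"

definition sigma2 :: "real mat" where
  "sigma2 = mat_of_rows_list 2 [[0, 1], [1, 0]]"

text \<open>
  The index \<open>j\<close> of \<open>spin_matrix g j\<close> runs from 1 to \<open>g\<close>. The case \<open>j = 1\<close>, with no factor
  \<open>sigma2\<close>, is an instance of the first branch.
\<close>

definition spin_matrix :: "nat \<Rightarrow> nat \<Rightarrow> real mat" where
  "spin_matrix g j =
     foldr kron
       (if j < g then replicate (j - 1) sigma2 @ [sigma1] @ replicate (g - j - 1) sigma0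
        else replicate (g - 1) sigma2)
       (1\<^sub>m 1)"

definition spin_tuple :: "nat \<Rightarrow> real mat list" where
  "spin_tuple g = map (spin_matrix g) [1..<Suc g]"

definition spin_ball :: "nat \<Rightarrow> nat \<Rightarrow> real mat list set" where
  "spin_ball g = free_spectrahedron (2 ^ (g - 1)) (spin_tuple g)"

definition scaled :: "real \<Rightarrow> (nat \<Rightarrow> real mat list set) \<Rightarrow> nat \<Rightarrow> real mat list set" where
  "scaled r K n = scale_tuple r ` K n"

text \<open>
  The dilation estimate with constant \<open>r\<close> for \<open>g\<close>-tuples. Only the scaling constant is replaced
  by \<open>r\<close>; the size \<open>g * n\<close> of the dilation is kept.
\<close>

definition dilation_estimate :: "nat \<Rightarrow> real \<Rightarrow> bool" where
  "dilation_estimate g r \<longleftrightarrow>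
     (\<forall>d \<ge> 1. \<forall>A \<in> sym_tuples g d.
        bounded_levels (free_spectrahedron d A) \<longrightarrow>
        coordinate_closed g (free_spectrahedron d A) \<longrightarrow>
        (\<forall>n \<ge> 1. \<forall>C \<in> free_spectrahedron d A n.
           \<exists>T \<in> free_spectrahedron d A (g * n).
             commuting_tuple T \<and> dilates_to n C (g * n) (scale_tuple r T)))"

end

theory Submission
  imports Defs "HOL-Analysis.Function_Topology"
begin

text \<open>
  Inclusion. If \<open>X\<close> is in the min ball, every \<open>X\<^sub>j\<close> is a contraction. As \<open>P\<^sub>j\<close> is a symmetric
  involution, \<open>P\<^sub>j \<otimes> X\<^sub>j \<preceq> I\<close>, and the sum of these \<open>g\<close> inequalities is the inclusion with constant \<open>g\<close>
  (\<open>min_ball_subset_spin_ball\<close>). The spin tuple \<open>P\<close> itself shows that \<open>g\<close> is optimal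
  (\<open>min_ball_subset_spin_ball_sharp\<close>): by the Clifford relations \<open>(\<Sum>\<^sub>j x\<^sub>j P\<^sub>j)\<^sup>2 = |x|\<^sup>2 I\<close>, so \<open>P\<close> is in the
  min ball, while \<open>\<Sum>\<^sub>j P\<^sub>j \<otimes> P\<^sub>j\<close> has the eigenvector \<open>\<Sum>\<^sub>a e\<^sub>a \<otimes> e\<^sub>a\<close> with eigenvalue \<open>g\<close>.
  
  Dilation (\<open>dilation_estimate_g\<close>). Let \<open>T\<^sub>j\<close> be the block diagonal matrix with \<open>C\<^sub>j\<close> in its \<open>j\<close>-th of \<open>g\<close>
  blocks and zeros elsewhere. The products \<open>T\<^sub>j T\<^sub>k\<close> vanish for \<open>j \<noteq> k\<close>, the isometry
  \<open>x \<mapsto> (x, \<dots>, x) / sqrt g\<close> compresses \<open>g T\<^sub>j\<close> to \<open>C\<^sub>j\<close>, and \<open>T\<close> satisfies the linear matrix inequality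
  because \<open>A\<^sub>j \<otimes> C\<^sub>j \<preceq> I\<close> for every \<open>j\<close>.
  
  Optimality of the dilation constant. For \<open>0 < \<rho> < g\<close> (\<open>not_dilation_estimate_pos\<close>) take diagonal
  coefficients whose inequalities are \<open>\<Sum>\<^sub>j c\<^sub>j X\<^sub>j \<preceq> I\<close> for the points \<open>c\<close> of a fine grid in the unit ball.
  Then \<open>P\<close> belongs to the set. A commuting tuple \<open>T\<close> in the set has its joint spectrum in a polytope that
  lies in a ball of radius \<open>R\<close> close to \<open>1\<close>, so \<open>\<Sum>\<^sub>j T\<^sub>j\<^sup>2 \<preceq> R\<^sup>2\<close> (\<open>sum_squares_bound\<close>). Commutation of the
  \<open>T\<^sub>j\<close> and anticommutation of the \<open>P\<^sub>j\<close> give \<open>(\<Sum>\<^sub>j P\<^sub>j \<otimes> T\<^sub>j)\<^sup>2 = I \<otimes> \<Sum>\<^sub>j T\<^sub>j\<^sup>2\<close>, whence \<open>\<Sum>\<^sub>j P\<^sub>j \<otimes> T\<^sub>j \<preceq> R\<close>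
  (\<open>commuting_spin_inequality\<close>). If \<open>P\<close> dilated to \<open>\<rho> T\<close>, this would bound the eigenvalue \<open>g\<close> of
  \<open>\<Sum>\<^sub>j P\<^sub>j \<otimes> P\<^sub>j\<close> by \<open>\<rho> R\<close>, which is less than \<open>g\<close> for a fine grid. For \<open>\<rho> \<le> 0\<close>
  (\<open>not_dilation_estimate_nonpos\<close>) the asymmetric box \<open>-1 \<le> X\<^sub>j \<le> 1 - \<rho>\<close> is a counterexample.
\<close>

section \<open>Vectors, symmetric matrices and quadratic forms\<close>

text \<open>
  A vector of \<open>\<real>\<^sup>n\<close> is represented by any function on \<open>nat\<close> with the right values below \<open>n\<close>, and
  a matrix by its entry function. The size is then an ordinary number, so the block decomposition of
  \<open>\<real>\<^sup>d \<otimes> \<real>\<^sup>n\<close> needs no conversions, and compactness of the unit sphere is available from the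
  product topology on \<open>nat \<Rightarrow> real\<close>. \<open>ip\<close> is the inner product and \<open>mv\<close> the matrix-vector product.
\<close>

definition ip :: "nat \<Rightarrow> (nat \<Rightarrow> real) \<Rightarrow> (nat \<Rightarrow> real) \<Rightarrow> real" where
  "ip n x y = (\<Sum>i<n. x i * y i)"

definition mv :: "nat \<Rightarrow> (nat \<Rightarrow> nat \<Rightarrow> real) \<Rightarrow> (nat \<Rightarrow> real) \<Rightarrow> nat \<Rightarrow> real" where
  "mv n M x = (\<lambda>i. \<Sum>k<n. M i k * x k)"

definition sym_kernel :: "nat \<Rightarrow> (nat \<Rightarrow> nat \<Rightarrow> real) \<Rightarrow> bool" where
  "sym_kernel n M \<longleftrightarrow> (\<forall>i<n. \<forall>k<n. M i k = M k i)"

lemma ip_commute: "ip n x y = ip n y x"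
  by (simp add: ip_def mult.commute)

lemma ip_add_left: "ip n (\<lambda>i. x i + y i) z = ip n x z + ip n y z"
  by (simp add: ip_def algebra_simps sum.distrib)

lemma ip_diff_left: "ip n (\<lambda>i. x i - y i) z = ip n x z - ip n y z"
  by (simp add: ip_def algebra_simps sum_subtractf)

lemma ip_scale_left: "ip n (\<lambda>i. c * x i) z = c * ip n x z"
  by (simp add: ip_def sum_distrib_left mult.assoc)

lemma ip_add_right: "ip n z (\<lambda>i. x i + y i) = ip n z x + ip n z y"
  and ip_diff_right: "ip n z (\<lambda>i. x i - y i) = ip n z x - ip n z y"
  and ip_scale_right: "ip n z (\<lambda>i. c * x i) = c * ip n z x"
  by (simp_all add: ip_commute[of n z] ip_add_left ip_diff_left ip_scale_left)

lemma mv_add: "mv n M (\<lambda>i. x i + y i) = (\<lambda>i. mv n M x i + mv n M y i)"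
  by (simp add: mv_def algebra_simps sum.distrib)

lemma mv_diff: "mv n M (\<lambda>i. x i - y i) = (\<lambda>i. mv n M x i - mv n M y i)"
  by (simp add: mv_def algebra_simps sum_subtractf)

lemma mv_scale: "mv n M (\<lambda>i. c * x i) = (\<lambda>i. c * mv n M x i)"
  by (simp add: mv_def sum_distrib_left algebra_simps)

lemmas ip_mv_linear = ip_add_left ip_diff_left ip_scale_left ip_add_right ip_diff_right
  ip_scale_right mv_add mv_diff mv_scale

lemma ip_cong: "(\<And>i. i < n \<Longrightarrow> x i = x' i) \<Longrightarrow> (\<And>i. i < n \<Longrightarrow> y i = y' i) \<Longrightarrow> ip n x y = ip n x' y'"
  by (simp add: ip_def)

lemma mv_cong: "(\<And>i. i < n \<Longrightarrow> x i = y i) \<Longrightarrow> mv n M x = mv n M y"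
  by (simp add: mv_def)

lemma ip_self_nonneg: "0 \<le> ip n x x"
  by (simp add: ip_def sum_nonneg)

lemma ip_self_eq_0: "ip n x x = 0 \<longleftrightarrow> (\<forall>i<n. x i = 0)"
  by (auto simp: ip_def sum_nonneg_eq_0_iff)

lemma ip_young: "2 * ip n x y \<le> ip n x x + ip n y y"
proof -
  have "0 \<le> ip n (\<lambda>i. x i - y i) (\<lambda>i. x i - y i)" by (rule ip_self_nonneg)
  then show ?thesis by (simp add: ip_mv_linear ip_commute[of n y x])
qed

lemma ip_mv_sym:
  assumes "sym_kernel n M"
  shows "ip n x (mv n M y) = ip n y (mv n M x)"
proof -
  have "ip n x (mv n M y) = (\<Sum>i<n. \<Sum>k<n. x i * (M i k * y k))"
    by (simp add: ip_def mv_def sum_distrib_left)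
  also have "\<dots> = (\<Sum>k<n. \<Sum>i<n. x i * (M i k * y k))" by (rule sum.swap)
  also have "\<dots> = (\<Sum>k<n. \<Sum>i<n. y k * (M k i * x i))"
    using assms by (intro sum.cong refl) (simp add: sym_kernel_def)
  finally show ?thesis by (simp add: ip_def mv_def sum_distrib_left)
qed

text \<open>
  By polarization, a bound on the quadratic form of a symmetric kernel bounds its bilinear form.
\<close>

lemma bilinear_bound:
  assumes "sym_kernel n M" and "\<And>x. \<bar>ip n x (mv n M x)\<bar> \<le> c * ip n x x"
  shows "2 * ip n x (mv n M y) \<le> c * (ip n x x + ip n y y)"
proof -
  have "ip n (\<lambda>i. x i + y i) (mv n M (\<lambda>i. x i + y i)) \<le> c * ip n (\<lambda>i. x i + y i) (\<lambda>i. x i + y i)"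
    "- (c * ip n (\<lambda>i. x i - y i) (\<lambda>i. x i - y i)) \<le> ip n (\<lambda>i. x i - y i) (mv n M (\<lambda>i. x i - y i))"
    using assms(2)[of "\<lambda>i. x i + y i"] assms(2)[of "\<lambda>i. x i - y i"] by linarith+
  then show ?thesis
    using ip_mv_sym[OF assms(1), of y x] by (simp add: ip_mv_linear algebra_simps)
qed

section \<open>Joint eigenvectors of commuting symmetric matrices\<close>

text \<open>
  Joint eigenspace of prescribed pairs (matrix, eigenvalue); with no pairs it is the whole space, so
  that one lemma covers both an unrestricted maximization and one inside earlier eigenspaces.
\<close>

definition eigenspace :: "nat \<Rightarrow> ((nat \<Rightarrow> nat \<Rightarrow> real) \<times> real) set \<Rightarrow> (nat \<Rightarrow> real) set" where
  "eigenspace N F = {v. \<forall>(M, \<mu>)\<in>F. \<forall>i<N. mv N M v i = \<mu> * v i}"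

definition commute_on :: "nat \<Rightarrow> (nat \<Rightarrow> nat \<Rightarrow> real) \<Rightarrow> (nat \<Rightarrow> nat \<Rightarrow> real) \<Rightarrow> bool" where
  "commute_on N M T \<longleftrightarrow> (\<forall>v. \<forall>i<N. mv N M (mv N T v) i = mv N T (mv N M v) i)"

lemma continuous_on_ip: "continuous_on S (\<lambda>v. ip N v v)"
  unfolding ip_def
  by (intro continuous_intros continuous_on_subset[OF continuous_on_product_coordinates subset_UNIV])

lemma continuous_on_mv: "continuous_on S (\<lambda>v. mv N M v i)"
  unfolding mv_def
  by (intro continuous_intros continuous_on_subset[OF continuous_on_product_coordinates subset_UNIV])

lemma continuous_on_quadratic: "continuous_on S (\<lambda>v. ip N v (mv N M v))"
  unfolding ip_def mv_def
  by (intro continuous_intros continuous_on_subset[OF continuous_on_product_coordinates subset_UNIV])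

lemma closed_eigenspace: "closed (eigenspace N F)"
proof -
  have "eigenspace N F = (\<Inter>(M, \<mu>)\<in>F. \<Inter>i\<in>{..<N}. {v. mv N M v i = \<mu> * v i})"
    by (auto simp: eigenspace_def)
  also have "closed \<dots>"
    by (auto intro!: closed_INT closed_Collect_eq continuous_on_mv continuous_intros
        continuous_on_subset[OF continuous_on_product_coordinates subset_UNIV] split: prod.splits)
  finally show ?thesis .
qed

text \<open>
  Fixing the coordinates from \<open>N\<close> on to \<open>0\<close> makes the cube of \<open>\<real>\<^sup>N\<close> compact in the full product space.
\<close>

lemma compact_cube:
  "compact {v :: nat \<Rightarrow> real. \<forall>i. v i \<in> (if i < N then {-1..1} else {0})}"
proof -
  have "compactin (product_topology (\<lambda>i. euclidean) UNIV)
      (PiE UNIV (\<lambda>i. if i < N then {-1..1 :: real} else {0}))"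
    by (auto simp: compactin_PiE compactin_euclidean_iff)
  moreover have "PiE UNIV (\<lambda>i. if i < N then {-1..1 :: real} else {0}) =
      {v. \<forall>i. v i \<in> (if i < N then {-1..1} else {0})}"
    by (auto simp: PiE_def Pi_def)
  ultimately show ?thesis
    by (simp add: euclidean_product_topology compactin_euclidean_iff)
qed

lemma eigenspace_cong:
  assumes "v \<in> eigenspace N F" "\<And>i. i < N \<Longrightarrow> w i = c * v i"
  shows "w \<in> eigenspace N F"
proof -
  have "mv N M w = (\<lambda>i. c * mv N M v i)" for M
    using mv_cong[of N w "\<lambda>i. c * v i"] assms(2) by (simp add: mv_scale)
  then show ?thesis using assms by (auto simp: eigenspace_def)
qed

text \<open>
  A maximizer \<open>v\<close> of the Rayleigh quotient of \<open>T\<close> on the unit sphere of the joint eigenspace is an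
  eigenvector: with \<open>\<mu>\<close> the maximum, the residual \<open>r = T v - \<mu> v\<close> stays in the eigenspace because \<open>T\<close>
  commutes with everything that defines it, and moving from \<open>v\<close> in direction \<open>r\<close> would increase the
  quotient to first order unless \<open>r = 0\<close>.
\<close>

lemma top_eigenvector:
  assumes T: "sym_kernel N T"
    and comm: "\<And>M \<mu>. (M, \<mu>) \<in> F \<Longrightarrow> commute_on N M T"
    and ne: "v\<^sub>0 \<in> eigenspace N F" "ip N v\<^sub>0 v\<^sub>0 \<noteq> 0"
  obtains v \<mu> where "ip N v v = 1" "v \<in> eigenspace N F" "\<And>i. i < N \<Longrightarrow> mv N T v i = \<mu> * v i"
    "\<And>w. w \<in> eigenspace N F \<Longrightarrow> ip N w (mv N T w) \<le> \<mu> * ip N w w"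
proof -
  define K where "K = {v :: nat \<Rightarrow> real. \<forall>i. v i \<in> (if i < N then {-1..1} else {0})} \<inter>
     ({v. ip N v v = 1} \<inter> eigenspace N F)"
  define q where "q v = ip N v (mv N T v)" for v
  \<comment> \<open>Normalization and truncation move any nonzero vector of the eigenspace into \<open>K\<close>.\<close>
  have unit: "\<exists>w'\<in>K. q w' = q w / ip N w w" if w: "w \<in> eigenspace N F" "ip N w w \<noteq> 0" for w
  proof
    define s where "s = 1 / sqrt (ip N w w)"
    define w' where "w' i = (if i < N then s * w i else 0)" for i
    have s2: "s * s = 1 / ip N w w"
      using ip_self_nonneg[of N w] by (simp add: s_def)
    have ipw: "ip N w' y = s * ip N w y" for y
      by (simp add: w'_def ip_def sum_distrib_left mult.assoc)
    have mvw: "mv N T w' = (\<lambda>i. s * mv N T w i)"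
      using mv_cong[of N w' "\<lambda>i. s * w i"] by (simp add: w'_def mv_scale)
    have "ip N w' w' = s * s * ip N w w"
      unfolding ipw ip_commute[of N w w'] by simp
    then have one: "ip N w' w' = 1" using s2 w(2) by simp
    have "w' i * w' i \<le> 1" if "i < N" for i
    proof -
      have "w' i * w' i \<le> ip N w' w'"
        unfolding ip_def using that by (intro member_le_sum) auto
      then show ?thesis using one by simp
    qed
    then have "\<bar>w' i\<bar> \<le> 1" if "i < N" for i
      using that abs_le_square_iff[of "w' i" 1] by (simp add: power2_eq_square)
    then have "\<forall>i. w' i \<in> (if i < N then {-1..1} else {0})"
      by (auto simp: abs_le_iff) (auto simp: w'_def minus_le_iff)
    moreover have "w' \<in> eigenspace N F"
      using eigenspace_cong[OF w(1), of w' s] by (simp add: w'_def)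
    ultimately show "w' \<in> K" using one by (simp add: K_def)
    show "q w' = q w / ip N w w"
      unfolding q_def ipw mvw ip_scale_right using s2 by (simp add: mult.assoc[symmetric])
  qed
  have "compact K"
    unfolding K_def
    by (intro compact_Int_closed compact_cube closed_Int closed_eigenspace closed_Collect_eq
        continuous_on_ip continuous_intros)
  moreover have "K \<noteq> {}" using unit[OF ne] by auto
  moreover have "continuous_on K q"
    unfolding q_def by (rule continuous_on_quadratic)
  ultimately obtain v where v: "v \<in> K" and max: "\<And>w. w \<in> K \<Longrightarrow> q w \<le> q v"
    by (metis continuous_attains_sup)
  define \<mu> where "\<mu> = q v"
  have v1: "ip N v v = 1" and vE: "v \<in> eigenspace N F" using v by (auto simp: K_def)
  have bound: "q w \<le> \<mu> * ip N w w" if "w \<in> eigenspace N F" for w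
  proof (cases "ip N w w = 0")
    case True
    then have "\<forall>i<N. w i = 0" by (simp only: ip_self_eq_0)
    then have "q w = 0" by (simp add: q_def ip_def)
    then show ?thesis using True by simp
  next
    case False
    then obtain w' where "w' \<in> K" "q w' = q w / ip N w w" using unit \<open>w \<in> _\<close> by blast
    then have "q w / ip N w w \<le> \<mu>" using max by (force simp: \<mu>_def)
    then show ?thesis using False ip_self_nonneg[of N w] by (simp add: field_simps)
  qed
  define r where "r i = mv N T v i - \<mu> * v i" for i
  have "mv N M r i = m * r i" if M: "(M, m) \<in> F" and i: "i < N" for M m i
  proof -
    have Mv: "mv N M v k = m * v k" if "k < N" for k
      using vE M that by (auto simp: eigenspace_def)
    have "mv N M (mv N T v) i = mv N T (mv N M v) i"
      using comm[OF M] i by (simp add: commute_on_def)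
    also have "mv N T (mv N M v) = mv N T (\<lambda>k. m * v k)"
      by (rule mv_cong) (rule Mv)
    finally have "mv N M (mv N T v) i = m * mv N T v i" by (simp add: mv_scale)
    then show ?thesis
      using Mv[OF i] by (simp add: r_def[abs_def] mv_diff mv_scale algebra_simps)
  qed
  then have rE: "r \<in> eigenspace N F" by (auto simp: eigenspace_def)
  define c where "c = \<mu> * ip N r r - q r"
  have c0: "0 \<le> c" using bound[OF rE] by (simp add: c_def)
  have rr: "ip N r (mv N T v) = ip N r r + \<mu> * ip N r v"
  proof -
    have "ip N r r = ip N r (\<lambda>i. mv N T v i - \<mu> * v i)" by (simp add: r_def[abs_def])
    then show ?thesis by (simp add: ip_mv_linear)
  qed
  have vTv: "ip N v (mv N T v) = \<mu>" by (simp add: \<mu>_def q_def)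
  \<comment> \<open>Maximality at \<open>v + t r\<close>: the terms of order \<open>0\<close> cancel and the linear one is \<open>2 t |r|\<^sup>2\<close>.\<close>
  have first_order: "2 * t * ip N r r \<le> t * t * c" for t
  proof -
    have "(\<lambda>i. v i + t * r i) \<in> eigenspace N F"
      using vE rE by (fastforce simp: eigenspace_def mv_add mv_scale algebra_simps)
    from bound[OF this] show ?thesis
      using v1 ip_mv_sym[OF T, of v r] rr vTv ip_commute[of N v r]
      by (simp add: q_def c_def ip_mv_linear algebra_simps)
  qed
  have "ip N r r = 0"
  proof (rule ccontr)
    assume "ip N r r \<noteq> 0"
    then have pos: "0 < ip N r r" using ip_self_nonneg[of N r] by linarith
    define t where "t = ip N r r / (c + 1)"
    have t: "0 < t" using pos c0 by (simp add: t_def)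
    have "2 * ip N r r \<le> t * c" using first_order[of t] t by (simp add: mult.assoc)
    also have "\<dots> \<le> ip N r r" using c0 pos by (simp add: t_def field_simps)
    finally show False using pos by simp
  qed
  then have "\<And>i. i < N \<Longrightarrow> mv N T v i = \<mu> * v i" by (auto simp: ip_self_eq_0 r_def)
  then show thesis using that[OF v1 vE _ bound[unfolded q_def]] by blast
qed

text \<open>
  An eigenvector of each matrix in turn is found inside the joint eigenspace of its predecessors, which
  the matrix leaves invariant.
\<close>

lemma joint_eigenvector:
  fixes k :: nat
  assumes "\<And>j. j < k \<Longrightarrow> sym_kernel N (T j)"
    and "\<And>i j. i < k \<Longrightarrow> j < k \<Longrightarrow> commute_on N (T i) (T j)"
    and "\<And>M m j. (M, m) \<in> F \<Longrightarrow> j < k \<Longrightarrow> commute_on N M (T j)"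
    and "v\<^sub>0 \<in> eigenspace N F" "ip N v\<^sub>0 v\<^sub>0 \<noteq> 0"
  shows "\<exists>v \<mu>. ip N v v \<noteq> 0 \<and> v \<in> eigenspace N F \<and> (\<forall>j<k. \<forall>i<N. mv N (T j) v i = \<mu> j * v i)"
  using assms
proof (induction k)
  case 0
  then show ?case by auto
next
  case (Suc k)
  then obtain v \<mu> where v: "ip N v v \<noteq> 0" "v \<in> eigenspace N F"
    "\<forall>j<k. \<forall>i<N. mv N (T j) v i = \<mu> j * v i"
    by (metis less_SucI)
  define F' where "F' = F \<union> (\<lambda>j. (T j, \<mu> j)) ` {..<k}"
  have "v \<in> eigenspace N F'" using v by (auto simp: F'_def eigenspace_def)
  moreover have "commute_on N M (T k)" if "(M, m) \<in> F'" for M m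
    using that Suc.prems(2,3) by (auto simp: F'_def)
  ultimately obtain w \<nu> where w: "ip N w w = 1" "w \<in> eigenspace N F'"
    "\<And>i. i < N \<Longrightarrow> mv N (T k) w i = \<nu> * w i"
    "\<And>x. x \<in> eigenspace N F' \<Longrightarrow> ip N x (mv N (T k) x) \<le> \<nu> * ip N x x"
    using top_eigenvector[OF Suc.prems(1)[OF lessI] _ _ v(1), of F'] by metis
  have "w \<in> eigenspace N F" "\<forall>j<k. \<forall>i<N. mv N (T j) w i = \<mu> j * w i"
    using w(2) by (auto simp: F'_def eigenspace_def)
  then show ?case
    using w by (intro exI[of _ w] exI[of _ "\<mu>(k := \<nu>)"]) (auto simp: less_Suc_eq)
qed

lemma mv_mv: "mv N A (mv N B v) i = (\<Sum>k<N. (\<Sum>l<N. A i l * B l k) * v k)"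
proof -
  have "mv N A (mv N B v) i = (\<Sum>l<N. \<Sum>k<N. A i l * B l k * v k)"
    by (simp add: mv_def sum_distrib_left mult.assoc)
  also have "\<dots> = (\<Sum>k<N. \<Sum>l<N. A i l * B l k * v k)" by (rule sum.swap)
  finally show ?thesis by (simp add: sum_distrib_right)
qed

lemma commute_onI:
  assumes "\<And>i k. i < N \<Longrightarrow> k < N \<Longrightarrow> (\<Sum>l<N. A i l * B l k) = (\<Sum>l<N. B i l * A l k)"
  shows "commute_on N A B"
  unfolding commute_on_def mv_mv using assms by simp

text \<open>
  Commuting symmetric matrices satisfy \<open>\<Sum>\<^sub>j T\<^sub>j\<^sup>2 \<preceq> c\<close> as soon as this holds on their joint spectrum.
  A full simultaneous diagonalization is avoided: \<open>S = \<Sum>\<^sub>j T\<^sub>j\<^sup>2\<close> commutes with all \<open>T\<^sub>j\<close>, so its top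
  eigenspace contains a joint eigenvector, and there the top eigenvalue of \<open>S\<close> is \<open>\<Sum>\<^sub>j \<mu>\<^sub>j\<^sup>2\<close>.
\<close>

lemma sum_squares_bound:
  fixes T :: "nat \<Rightarrow> nat \<Rightarrow> nat \<Rightarrow> real"
  assumes sym: "\<And>j. j < g \<Longrightarrow> sym_kernel N (T j)"
    and comm: "\<And>i j. i < g \<Longrightarrow> j < g \<Longrightarrow> commute_on N (T i) (T j)"
    and spectrum: "\<And>v \<mu>. ip N v v \<noteq> 0 \<Longrightarrow> \<forall>j<g. \<forall>i<N. mv N (T j) v i = \<mu> j * v i
      \<Longrightarrow> (\<Sum>j<g. \<mu> j * \<mu> j) \<le> c"
  shows "(\<Sum>j<g. ip N (mv N (T j) w) (mv N (T j) w)) \<le> c * ip N w w"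
proof (cases "ip N w w = 0")
  case True
  then have "mv N (T j) w = (\<lambda>i. 0)" for j by (simp add: ip_self_eq_0 mv_def)
  then show ?thesis using True by (simp add: ip_def)
next
  case False
  define S where "S i k = (\<Sum>j<g. \<Sum>l<N. T j i l * T j l k)" for i k
  have mvS: "mv N S v i = (\<Sum>j<g. mv N (T j) (mv N (T j) v) i)" for v i
  proof -
    have "mv N S v i = (\<Sum>k<N. \<Sum>j<g. (\<Sum>l<N. T j i l * T j l k) * v k)"
      by (simp add: mv_def S_def sum_distrib_right)
    also have "\<dots> = (\<Sum>j<g. \<Sum>k<N. (\<Sum>l<N. T j i l * T j l k) * v k)" by (rule sum.swap)
    finally show ?thesis by (simp add: mv_mv)
  qed
  have "S i k = S k i" if "i < N" "k < N" for i k
    unfolding S_def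
  proof (intro sum.cong refl)
    fix j l assume "j \<in> {..<g}" "l \<in> {..<N}"
    then have "T j i l = T j l i" "T j l k = T j k l"
      using sym[of j] that by (auto simp: sym_kernel_def)
    then show "T j i l * T j l k = T j k l * T j l i" by simp
  qed
  then have symS: "sym_kernel N S" by (simp add: sym_kernel_def)
  have commS: "commute_on N S (T j)" if j: "j < g" for j
    unfolding commute_on_def
  proof (intro allI impI)
    fix v i assume i: "i < N"
    have "mv N (T a) (mv N (T a) (mv N (T j) v)) i = mv N (T j) (mv N (T a) (mv N (T a) v)) i"
      if "a < g" for a
    proof -
      have "mv N (T a) (mv N (T a) (mv N (T j) v)) = mv N (T a) (mv N (T j) (mv N (T a) v))"
        by (rule mv_cong) (use comm[OF that j] in \<open>simp add: commute_on_def\<close>)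
      then show ?thesis using comm[OF that j] i by (simp add: commute_on_def)
    qed
    moreover have "mv N (T j) (mv N S v) i = (\<Sum>a<g. mv N (T j) (mv N (T a) (mv N (T a) v)) i)"
    proof -
      have "mv N (T j) (mv N S v) i = (\<Sum>k<N. \<Sum>a<g. T j i k * mv N (T a) (mv N (T a) v) k)"
        unfolding mv_def[of N "T j" "mv N S v"] by (simp add: mvS sum_distrib_left)
      also have "\<dots> = (\<Sum>a<g. \<Sum>k<N. T j i k * mv N (T a) (mv N (T a) v) k)" by (rule sum.swap)
      finally show ?thesis by (simp add: mv_def[of N "T j"])
    qed
    ultimately show "mv N S (mv N (T j) v) i = mv N (T j) (mv N S v) i"
      by (simp add: mvS)
  qed
  obtain v \<sigma> where v: "ip N v v = 1" "\<And>i. i < N \<Longrightarrow> mv N S v i = \<sigma> * v i"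
    and top: "\<And>w. ip N w (mv N S w) \<le> \<sigma> * ip N w w"
    using top_eigenvector[OF symS, of "{}" w] False by (auto simp: eigenspace_def)
  have "v \<in> eigenspace N {(S, \<sigma>)}" using v by (auto simp: eigenspace_def)
  then obtain u \<mu> where u: "ip N u u \<noteq> 0" "u \<in> eigenspace N {(S, \<sigma>)}"
    "\<forall>j<g. \<forall>i<N. mv N (T j) u i = \<mu> j * u i"
    using joint_eigenvector[of g N T "{(S, \<sigma>)}" v] sym comm commS v by auto
  have Tu: "mv N (T j) (mv N (T j) u) i = \<mu> j * \<mu> j * u i" if "j < g" "i < N" for i j
  proof -
    have "mv N (T j) (mv N (T j) u) = mv N (T j) (\<lambda>i. \<mu> j * u i)"
      by (rule mv_cong) (use u(3) that in simp)
    then show ?thesis using u(3) that by (simp add: mv_scale)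
  qed
  obtain i where i: "i < N" "u i \<noteq> 0" using u(1) by (auto simp: ip_self_eq_0)
  have "\<sigma> * u i = mv N S u i" using u(2) i by (simp add: eigenspace_def)
  also have "\<dots> = (\<Sum>j<g. \<mu> j * \<mu> j) * u i" using Tu i by (simp add: mvS sum_distrib_right)
  finally have "\<sigma> \<le> c" using spectrum[OF u(1,3)] i by simp
  have "(\<Sum>j<g. ip N (mv N (T j) w) (mv N (T j) w)) = (\<Sum>j<g. ip N w (mv N (T j) (mv N (T j) w)))"
    using ip_mv_sym[OF sym] by (intro sum.cong refl) simp
  also have "\<dots> = (\<Sum>i<N. \<Sum>j<g. w i * mv N (T j) (mv N (T j) w) i)"
    unfolding ip_def by (rule sum.swap)
  also have "\<dots> = ip N w (mv N S w)" by (simp add: ip_def mvS sum_distrib_left)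
  also have "\<dots> \<le> \<sigma> * ip N w w" by (rule top)
  also have "\<dots> \<le> c * ip N w w" using \<open>\<sigma> \<le> c\<close> ip_self_nonneg by (rule mult_right_mono)
  finally show ?thesis .
qed

section \<open>Matrix inequalities as inequalities of quadratic forms\<close>

abbreviation entries :: "real mat \<Rightarrow> nat \<Rightarrow> nat \<Rightarrow> real" where
  "entries M \<equiv> \<lambda>i k. M $$ (i, k)"

lemma sum_lessThan_mult:
  fixes f :: "nat \<Rightarrow> 'a :: comm_monoid_add"
  shows "(\<Sum>p<d * n. f p) = (\<Sum>a<d. \<Sum>i<n. f (a * n + i))"
proof -
  have "sum f {a * n..<a * n + n} = (\<Sum>i<n. f (a * n + i))" for a
    by (simp add: sum.atLeastLessThan_shift_0[of f "a * n"] atLeast0LessThan)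
  then show ?thesis by (simp add: sum.nat_group[symmetric])
qed

lemma sym_tuples_nth:
  assumes "X \<in> sym_tuples g n" "j < g"
  shows "X ! j \<in> carrier_mat n n" "transpose_mat (X ! j) = X ! j" "sym_kernel n (entries (X ! j))"
proof -
  show c: "X ! j \<in> carrier_mat n n" and t: "transpose_mat (X ! j) = X ! j"
    using assms by (auto simp: sym_tuples_def)
  show "sym_kernel n (entries (X ! j))"
    unfolding sym_kernel_def using c by (metis t carrier_matD index_transpose_mat(1))
qed

lemma sym_tuples_length: "X \<in> sym_tuples g n \<Longrightarrow> length X = g"
  by (simp add: sym_tuples_def)

lemma transpose_eq_iff_sym_kernel:
  assumes "M \<in> carrier_mat n n"
  shows "transpose_mat M = M \<longleftrightarrow> sym_kernel n (entries M)"
proof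
  assume "transpose_mat M = M"
  then show "sym_kernel n (entries M)"
    unfolding sym_kernel_def using assms by (metis carrier_matD index_transpose_mat(1))
next
  assume "sym_kernel n (entries M)"
  then show "transpose_mat M = M"
    using assms by (intro eq_matI) (auto simp: sym_kernel_def)
qed

lemma msum_entries:
  assumes "\<forall>M \<in> set Ms. M \<in> carrier_mat n n"
  shows "msum n Ms \<in> carrier_mat n n"
    and "i < n \<Longrightarrow> k < n \<Longrightarrow> msum n Ms $$ (i, k) = (\<Sum>M\<leftarrow>Ms. M $$ (i, k))"
  using assms by (induction Ms) (auto simp: msum_def)

lemma scalar_prod_mult_mat_vec:
  assumes "M \<in> carrier_mat n n" "v \<in> carrier_vec n"
  shows "v \<bullet> (M *\<^sub>v v) = ip n (vec_index v) (mv n (entries M) (vec_index v))"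
  using assms
  by (auto simp: scalar_prod_def ip_def mv_def atLeast0LessThan intro!: sum.cong)

lemma psd_iff:
  assumes "M \<in> carrier_mat n n" "sym_kernel n (entries M)"
  shows "psd M \<longleftrightarrow> (\<forall>x. 0 \<le> ip n x (mv n (entries M) x))"
proof -
  have "(\<forall>v\<in>carrier_vec n. 0 \<le> v \<bullet> (M *\<^sub>v v)) \<longleftrightarrow> (\<forall>x. 0 \<le> ip n x (mv n (entries M) x))"
  proof (intro iffI ballI allI)
    fix x assume *: "\<forall>v\<in>carrier_vec n. 0 \<le> v \<bullet> (M *\<^sub>v v)"
    have "ip n (vec_index (vec n x)) (mv n (entries M) (vec_index (vec n x))) =
        ip n x (mv n (entries M) x)"
      by (intro ip_cong) (simp_all add: mv_cong[of n "vec_index (vec n x)" x])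
    then show "0 \<le> ip n x (mv n (entries M) x)"
      using * scalar_prod_mult_mat_vec[OF assms(1), of "vec n x"] by (metis vec_carrier)
  qed (simp add: scalar_prod_mult_mat_vec[OF assms(1)])
  then show ?thesis
    using assms transpose_eq_iff_sym_kernel[OF assms(1)] by (simp add: psd_def)
qed

lemma psd_one_minus_msum:
  assumes K: "\<And>j. j < g \<Longrightarrow> K j \<in> carrier_mat n n" "\<And>j. j < g \<Longrightarrow> sym_kernel n (entries (K j))"
  shows "psd (1\<^sub>m n - msum n (map K [0..<g])) \<longleftrightarrow>
    (\<forall>x. (\<Sum>j<g. ip n x (mv n (entries (K j)) x)) \<le> ip n x x)"
proof -
  define S where "S = msum n (map K [0..<g])"
  have S: "S \<in> carrier_mat n n" "\<And>i k. i < n \<Longrightarrow> k < n \<Longrightarrow> S $$ (i, k) = (\<Sum>j<g. K j $$ (i, k))"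
    using msum_entries[of "map K [0..<g]" n] K(1)
    by (auto simp: S_def interv_sum_list_conv_sum_set_nat atLeast0LessThan o_def)
  have symS: "S $$ (i, k) = S $$ (k, i)" if "i < n" "k < n" for i k
    using that K(2) by (auto simp: S sym_kernel_def intro!: sum.cong)
  have "mv n (entries (1\<^sub>m n - S)) x i = x i - (\<Sum>j<g. mv n (entries (K j)) x i)" if i: "i < n" for x i
  proof -
    have "mv n (entries (1\<^sub>m n - S)) x i =
        (\<Sum>k<n. (if i = k then x k else 0) - (\<Sum>j<g. K j $$ (i, k) * x k))"
      unfolding mv_def using i S
      by (intro sum.cong refl) (auto simp: algebra_simps sum_distrib_left)
    also have "\<dots> = x i - (\<Sum>k<n. \<Sum>j<g. K j $$ (i, k) * x k)"
      using i by (simp add: sum_subtractf)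
    also have "(\<Sum>k<n. \<Sum>j<g. K j $$ (i, k) * x k) = (\<Sum>j<g. mv n (entries (K j)) x i)"
      unfolding mv_def by (rule sum.swap)
    finally show ?thesis .
  qed
  then have "ip n x (mv n (entries (1\<^sub>m n - S)) x) =
      ip n x (\<lambda>i. x i - (\<Sum>j<g. mv n (entries (K j)) x i))" for x
    by (intro ip_cong) simp_all
  moreover have "ip n x (\<lambda>i. \<Sum>j<g. mv n (entries (K j)) x i) =
      (\<Sum>j<g. ip n x (mv n (entries (K j)) x))" for x
  proof -
    have "ip n x (\<lambda>i. \<Sum>j<g. mv n (entries (K j)) x i) =
      (\<Sum>i<n. \<Sum>j<g. x i * mv n (entries (K j)) x i)"
      by (simp add: ip_def sum_distrib_left)
    also have "\<dots> = (\<Sum>j<g. ip n x (mv n (entries (K j)) x))"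
      unfolding ip_def by (rule sum.swap)
    finally show ?thesis .
  qed
  ultimately have "ip n x (mv n (entries (1\<^sub>m n - S)) x) =
      ip n x x - (\<Sum>j<g. ip n x (mv n (entries (K j)) x))" for x
    by (simp add: ip_mv_linear)
  moreover have "1\<^sub>m n - S \<in> carrier_mat n n" using S(1) by (rule minus_carrier_mat)
  moreover have "sym_kernel n (entries (1\<^sub>m n - S))"
    using S(1) symS by (auto simp: sym_kernel_def)
  ultimately show ?thesis
    using psd_iff[of "1\<^sub>m n - S" n] by (simp add: S_def)
qed

lemma div_mod_less:
  fixes p d n :: nat
  assumes "p < d * n"
  shows "p div n < d" "p mod n < n"
proof -
  show "p div n < d" using assms by (simp add: less_mult_imp_div_less)
  show "p mod n < n" using assms by (cases "n = 0") auto
qed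

lemma kron_dim[simp]:
  "dim_row (kron A B) = dim_row A * dim_row B" "dim_col (kron A B) = dim_col A * dim_col B"
  by (simp_all add: kron_def)

lemma kron_carrier:
  "A \<in> carrier_mat a b \<Longrightarrow> B \<in> carrier_mat c d \<Longrightarrow> kron A B \<in> carrier_mat (a * c) (b * d)"
  by (intro carrier_matI) auto

lemma kron_index:
  "A \<in> carrier_mat a b \<Longrightarrow> B \<in> carrier_mat c d \<Longrightarrow> p < a * c \<Longrightarrow> q < b * d \<Longrightarrow>
    kron A B $$ (p, q) = A $$ (p div c, q div d) * B $$ (p mod c, q mod d)"
  by (auto simp: kron_def)

lemma block_index_less:
  fixes a d i n :: nat
  assumes "a < d" "i < n"
  shows "a * n + i < d * n"
proof -
  have "a * n + i < Suc a * n" using assms by simp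
  also have "\<dots> \<le> d * n" using assms by (intro mult_le_mono1) simp
  finally show ?thesis .
qed

lemma kron_block_index:
  assumes "A \<in> carrier_mat d d" "B \<in> carrier_mat n n" "a < d" "b < d" "i < n" "k < n"
  shows "kron A B $$ (a * n + i, b * n + k) = A $$ (a, b) * B $$ (i, k)"
  using kron_index[OF assms(1,2) block_index_less[OF assms(3,5)] block_index_less[OF assms(4,6)]]
    assms by simp

text \<open>
  A vector of \<open>\<real>\<^sup>d \<otimes> \<real>\<^sup>n\<close> is a sequence of \<open>d\<close> blocks of length \<open>n\<close>, and \<open>A \<otimes> B\<close> acts on the blocks
  with the entries of \<open>A\<close> as coefficients.
\<close>

lemma kron_form:
  assumes "A \<in> carrier_mat d d" "B \<in> carrier_mat n n"
  shows "ip (d * n) x (mv (d * n) (entries (kron A B)) x) =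
    (\<Sum>a<d. \<Sum>b<d. A $$ (a, b) * ip n (\<lambda>i. x (a * n + i)) (mv n (entries B) (\<lambda>i. x (b * n + i))))"
proof -
  have "ip (d * n) x (mv (d * n) (entries (kron A B)) x) =
    (\<Sum>a<d. \<Sum>i<n. \<Sum>b<d. \<Sum>k<n. x (a * n + i) *
       (A $$ (a, b) * B $$ (i, k) * x (b * n + k)))"
    unfolding ip_def mv_def sum_lessThan_mult sum_distrib_left
    by (intro sum.cong refl) (simp add: kron_block_index[OF assms])
  also have "\<dots> = (\<Sum>a<d. \<Sum>b<d. \<Sum>i<n. \<Sum>k<n. x (a * n + i) *
       (A $$ (a, b) * B $$ (i, k) * x (b * n + k)))"
    by (intro sum.cong refl sum.swap)
  also have "\<dots> = (\<Sum>a<d. \<Sum>b<d. A $$ (a, b) * ip n (\<lambda>i. x (a * n + i)) (mv n (entries B) (\<lambda>i. x (b * n + i))))"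
    by (simp add: ip_def mv_def sum_distrib_left algebra_simps)
  finally show ?thesis .
qed

lemma kron_sym_kernel:
  assumes "A \<in> carrier_mat d d" "B \<in> carrier_mat n n"
    "sym_kernel d (entries A)" "sym_kernel n (entries B)"
  shows "sym_kernel (d * n) (entries (kron A B))"
  using assms(3,4) div_mod_less by (auto simp: sym_kernel_def kron_index[OF assms(1,2)])

text \<open>
  The linear matrix inequality, with a vector of \<open>\<real>\<^sup>d \<otimes> \<real>\<^sup>n\<close> written as the family \<open>u\<close> of its \<open>d\<close>
  blocks.
\<close>

lemma free_spectrahedron_iff:
  assumes A: "A \<in> sym_tuples g d"
  shows "X \<in> free_spectrahedron d A n \<longleftrightarrow> X \<in> sym_tuples g n \<and>
    (\<forall>u. (\<Sum>j<g. \<Sum>a<d. \<Sum>b<d. A ! j $$ (a, b) * ip n (u a) (mv n (entries (X ! j)) (u b)))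
      \<le> (\<Sum>a<d. ip n (u a) (u a)))"
proof (cases "X \<in> sym_tuples g n")
  case X: True
  note A' = sym_tuples_nth[OF A] and X' = sym_tuples_nth[OF X]
  define f where "f u = (\<Sum>j<g. \<Sum>a<d. \<Sum>b<d. A ! j $$ (a, b) * ip n (u a) (mv n (entries (X ! j)) (u b)))"
    for u
  have ip: "ip (d * n) x x = (\<Sum>a<d. ip n (\<lambda>i. x (a * n + i)) (\<lambda>i. x (a * n + i)))" for x
    by (simp add: ip_def sum_lessThan_mult)
  have "psd (1\<^sub>m (d * n) - msum (d * n) (map (\<lambda>j. kron (A ! j) (X ! j)) [0..<g])) \<longleftrightarrow>
    (\<forall>x. f (\<lambda>a i. x (a * n + i)) \<le> (\<Sum>a<d. ip n (\<lambda>i. x (a * n + i)) (\<lambda>i. x (a * n + i))))"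
    by (subst psd_one_minus_msum)
      (auto simp: A' X' kron_carrier kron_sym_kernel kron_form[OF A'(1) X'(1)] ip f_def)
  also have "\<dots> \<longleftrightarrow> (\<forall>u. f u \<le> (\<Sum>a<d. ip n (u a) (u a)))"
  proof (intro iffI allI)
    fix u :: "nat \<Rightarrow> nat \<Rightarrow> real"
    assume *: "\<forall>x. f (\<lambda>a i. x (a * n + i)) \<le>
      (\<Sum>a<d. ip n (\<lambda>i. x (a * n + i)) (\<lambda>i. x (a * n + i)))"
    define u' where "u' = (\<lambda>a i. (\<lambda>p. u (p div n) (p mod n)) (a * n + i))"
    have eq: "u' a i = u a i" if "i < n" for a i using that by (simp add: u'_def)
    have "ip n (u' a) (u' a) = ip n (u a) (u a)" for a
      by (rule ip_cong) (simp_all add: eq)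
    moreover have "ip n (u' a) (mv n M (u' b)) = ip n (u a) (mv n M (u b))" for a b M
      using mv_cong[of n "u' b" "u b"] by (intro ip_cong) (simp_all add: eq)
    then have "f u' = f u" by (simp add: f_def)
    moreover have "f u' \<le> (\<Sum>a<d. ip n (u' a) (u' a))"
      unfolding u'_def by (rule *[rule_format])
    ultimately show "f u \<le> (\<Sum>a<d. ip n (u a) (u a))" by simp
  qed simp
  finally show ?thesis
    using X sym_tuples_length[OF A] by (simp add: free_spectrahedron_def f_def)
qed (use sym_tuples_length[OF A] in \<open>simp add: free_spectrahedron_def\<close>)

lemma mv_smult:
  assumes "M \<in> carrier_mat n n" "i < n"
  shows "mv n (entries (c \<cdot>\<^sub>m M)) x i = c * mv n (entries M) x i"
  using assms by (auto simp: mv_def sum_distrib_left intro!: sum.cong)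

lemma ip_mv_smult:
  assumes "M \<in> carrier_mat n n"
  shows "ip n y (mv n (entries (c \<cdot>\<^sub>m M)) x) = c * ip n y (mv n (entries M) x)"
  unfolding ip_scale_right[symmetric] using assms by (intro ip_cong) (simp_all add: mv_smult)

lemma min_ball_iff:
  "X \<in> min_ball g n \<longleftrightarrow> X \<in> sym_tuples g n \<and>
    (\<forall>c x. (\<Sum>j<g. c j * c j) = 1 \<longrightarrow> (\<Sum>j<g. c j * ip n x (mv n (entries (X ! j)) x)) \<le> ip n x x)"
proof (cases "X \<in> sym_tuples g n")
  case X: True
  note X' = sym_tuples_nth[OF X]
  have "psd (1\<^sub>m n - msum n (map (\<lambda>j. c j \<cdot>\<^sub>m X ! j) [0..<g])) \<longleftrightarrow>
    (\<forall>x. (\<Sum>j<g. c j * ip n x (mv n (entries (X ! j)) x)) \<le> ip n x x)" for c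
  proof (subst psd_one_minus_msum)
    fix j assume "j < g"
    then show "c j \<cdot>\<^sub>m X ! j \<in> carrier_mat n n" using X' by simp
    then show "sym_kernel n (entries (c j \<cdot>\<^sub>m X ! j))"
      using X'(1,3)[OF \<open>j < g\<close>] by (auto simp: sym_kernel_def)
  next
    show "(\<forall>x. (\<Sum>j<g. ip n x (mv n (entries (c j \<cdot>\<^sub>m X ! j)) x)) \<le> ip n x x) \<longleftrightarrow>
      (\<forall>x. (\<Sum>j<g. c j * ip n x (mv n (entries (X ! j)) x)) \<le> ip n x x)"
      by (simp add: ip_mv_smult[OF X'(1)])
  qed
  note psd = this
  have "(\<forall>c\<in>carrier_vec g. c \<bullet> c = 1 \<longrightarrow> psd (1\<^sub>m n - msum n (map (\<lambda>j. c $ j \<cdot>\<^sub>m X ! j) [0..<g]))) \<longleftrightarrow>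
    (\<forall>c. (\<Sum>j<g. c j * c j) = 1 \<longrightarrow> psd (1\<^sub>m n - msum n (map (\<lambda>j. c j \<cdot>\<^sub>m X ! j) [0..<g])))"
  proof (intro iffI ballI allI impI)
    fix c :: "nat \<Rightarrow> real"
    assume *: "\<forall>c\<in>carrier_vec g. c \<bullet> c = 1 \<longrightarrow>
      psd (1\<^sub>m n - msum n (map (\<lambda>j. c $ j \<cdot>\<^sub>m X ! j) [0..<g]))"
      and "(\<Sum>j<g. c j * c j) = 1"
    then have "vec g c \<bullet> vec g c = 1" by (simp add: scalar_prod_def atLeast0LessThan)
    then have "psd (1\<^sub>m n - msum n (map (\<lambda>j. vec g c $ j \<cdot>\<^sub>m X ! j) [0..<g]))"
      using * by simp
    moreover have "map (\<lambda>j. vec g c $ j \<cdot>\<^sub>m X ! j) [0..<g] = map (\<lambda>j. c j \<cdot>\<^sub>m X ! j) [0..<g]"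
      by simp
    ultimately show "psd (1\<^sub>m n - msum n (map (\<lambda>j. c j \<cdot>\<^sub>m X ! j) [0..<g]))" by simp
  next
    fix c :: "real vec"
    assume "\<forall>c. (\<Sum>j<g. c j * c j) = 1 \<longrightarrow> psd (1\<^sub>m n - msum n (map (\<lambda>j. c j \<cdot>\<^sub>m X ! j) [0..<g]))"
      "c \<in> carrier_vec g" "c \<bullet> c = 1"
    then show "psd (1\<^sub>m n - msum n (map (\<lambda>j. c $ j \<cdot>\<^sub>m X ! j) [0..<g]))"
      by (auto simp: scalar_prod_def atLeast0LessThan)
  qed
  then show ?thesis using X by (simp add: min_ball_def psd)
qed (simp add: min_ball_def)

section \<open>The spin matrices\<close>

lemma mat_eqI_index:
  assumes "A \<in> carrier_mat m n" "B \<in> carrier_mat m n"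
    "\<And>i j. i < m \<Longrightarrow> j < n \<Longrightarrow> A $$ (i, j) = B $$ (i, j)"
  shows "A = B"
  using assms by (intro eq_matI) auto

lemma mult_index_sum:
  assumes "A \<in> carrier_mat m l" "B \<in> carrier_mat l n" "i < m" "j < n"
  shows "(A * B) $$ (i, j) = (\<Sum>k<l. A $$ (i, k) * B $$ (k, j))"
  using assms by (auto simp: scalar_prod_def atLeast0LessThan intro!: sum.cong)

lemma kron_mult:
  assumes "A \<in> carrier_mat d d" "A' \<in> carrier_mat d d" "B \<in> carrier_mat n n" "B' \<in> carrier_mat n n"
  shows "kron A B * kron A' B' = kron (A * A') (B * B')"
proof (rule mat_eqI_index)
  show "kron A B * kron A' B' \<in> carrier_mat (d * n) (d * n)"
    "kron (A * A') (B * B') \<in> carrier_mat (d * n) (d * n)"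
    using assms by (auto intro!: mult_carrier_mat kron_carrier)
  fix p q assume p: "p < d * n" and q: "q < d * n"
  have "(kron A B * kron A' B') $$ (p, q) = (\<Sum>r<d * n. kron A B $$ (p, r) * kron A' B' $$ (r, q))"
    using assms p q by (intro mult_index_sum) (auto intro!: kron_carrier)
  also have "\<dots> = (\<Sum>a<d. \<Sum>i<n. A $$ (p div n, a) * B $$ (p mod n, i) *
      (A' $$ (a, q div n) * B' $$ (i, q mod n)))"
    unfolding sum_lessThan_mult
    using p q by (intro sum.cong refl)
      (simp add: kron_index[OF assms(1,3)] kron_index[OF assms(2,4)] block_index_less)
  also have "\<dots> = (\<Sum>a<d. A $$ (p div n, a) * A' $$ (a, q div n)) *
      (\<Sum>i<n. B $$ (p mod n, i) * B' $$ (i, q mod n))"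
    by (simp add: sum_product algebra_simps)
  also have "\<dots> = kron (A * A') (B * B') $$ (p, q)"
    using p q div_mod_less[OF p] div_mod_less[OF q] assms
    by (subst kron_index[of _ d d _ n n])
      (auto simp: mult_index_sum[OF assms(1,2)] mult_index_sum[OF assms(3,4)]
        simp del: index_mult_mat intro: mult_carrier_mat)
  finally show "(kron A B * kron A' B') $$ (p, q) = kron (A * A') (B * B') $$ (p, q)" .
qed

lemma kron_add:
  assumes "A \<in> carrier_mat d d" "A' \<in> carrier_mat d d" "B \<in> carrier_mat n n" "B' \<in> carrier_mat n n"
  shows "kron A B + kron A B' = kron A (B + B')" "kron A B + kron A' B = kron (A + A') B"
  using assms div_mod_less
  by (auto intro!: mat_eqI_index[of _ "d * n" "d * n"] add_carrier_mat kron_carrier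
      simp: kron_index[of _ d d _ n n] algebra_simps)

lemma kron_one: "kron (1\<^sub>m d) (1\<^sub>m n) = 1\<^sub>m (d * n)"
proof (rule mat_eqI_index)
  fix p q assume p: "p < d * n" and q: "q < d * n"
  have "p = q \<longleftrightarrow> p div n = q div n \<and> p mod n = q mod n"
    by (metis div_mult_mod_eq)
  then show "kron (1\<^sub>m d) (1\<^sub>m n) $$ (p, q) = 1\<^sub>m (d * n) $$ (p, q)"
    using p q div_mod_less[OF p] div_mod_less[OF q]
    by (auto simp: kron_index[OF one_carrier_mat one_carrier_mat])
qed (auto intro: kron_carrier)

lemma sigma_carrier: "sigma0 \<in> carrier_mat 2 2" "sigma1 \<in> carrier_mat 2 2" "sigma2 \<in> carrier_mat 2 2"
  by (auto simp: sigma0_def sigma1_def sigma2_def mat_of_rows_list_def)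

lemma sigma_entries:
  "sigma1 $$ (0, 0) = 1" "sigma1 $$ (0, 1) = 0" "sigma1 $$ (1, 0) = 0" "sigma1 $$ (1, 1) = - 1"
  "sigma2 $$ (0, 0) = 0" "sigma2 $$ (0, 1) = 1" "sigma2 $$ (1, 0) = 1" "sigma2 $$ (1, 1) = 0"
  by (simp_all add: sigma1_def sigma2_def mat_of_rows_list_def)

lemma sum_lessThan_2: "(\<Sum>i<2. f i) = f 0 + f (1::nat)"
  by (simp add: numeral_2_eq_2)

lemma less_two_iff: "i < 2 \<longleftrightarrow> i = 0 \<or> i = (1::nat)"
  by auto

lemma sigma_mult:
  "sigma1 * sigma1 = 1\<^sub>m 2" "sigma2 * sigma2 = 1\<^sub>m 2"
  "sigma1 * sigma2 + sigma2 * sigma1 = 0\<^sub>m 2 2"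
  by (rule mat_eqI_index[of _ 2 2];
      auto simp: mult_index_sum[of _ 2 2 _ 2] sigma_carrier carrier_matD[OF sigma_carrier(2)] carrier_matD[OF sigma_carrier(3)] sum_lessThan_2 sigma_entries[unfolded One_nat_def] less_two_iff
        mult_carrier_mat[OF sigma_carrier(2,3)] mult_carrier_mat[OF sigma_carrier(3,2)]
        simp del: index_mult_mat(1) intro: mult_carrier_mat[of _ 2 2 _ 2] sigma_carrier)+

lemma sigma_sym: "sym_kernel 2 (entries sigma1)" "sym_kernel 2 (entries sigma2)"
  by (auto simp: sym_kernel_def less_two_iff sigma_entries[unfolded One_nat_def])

text \<open>
  The tuple is generated from \<open>g = 1\<close>, where it is the single matrix \<open>1\<close>, by passing from
  \<open>P\<^sub>1, \<dots>, P\<^sub>g\<close> to \<open>\<sigma>\<^sub>1 \<otimes> I, \<sigma>\<^sub>2 \<otimes> P\<^sub>1, \<dots>, \<sigma>\<^sub>2 \<otimes> P\<^sub>g\<close>.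
\<close>

lemma spin_matrix_base: "spin_matrix 1 1 = 1\<^sub>m 1"
  by (simp add: spin_matrix_def)

lemma spin_matrix_first:
  assumes "1 \<le> g"
  shows "spin_matrix (Suc g) 1 = kron sigma1 (1\<^sub>m (2 ^ (g - 1)))"
proof -
  have "foldr kron (replicate k sigma0) (1\<^sub>m 1) = 1\<^sub>m (2 ^ k)" for k
    by (induction k) (simp_all add: sigma0_def kron_one)
  then show ?thesis using assms by (simp add: spin_matrix_def)
qed

lemma spin_matrix_later:
  assumes "1 \<le> j" "j \<le> g"
  shows "spin_matrix (Suc g) (Suc j) = kron sigma2 (spin_matrix g j)"
proof -
  obtain i where j: "j = Suc i" using assms by (cases j) auto
  obtain h where g: "g = Suc h" using assms by (cases g) auto
  show ?thesis by (simp add: spin_matrix_def j g)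
qed

lemma kron_zero_left: "B \<in> carrier_mat n n \<Longrightarrow> kron (0\<^sub>m d d) B = 0\<^sub>m (d * n) (d * n)"
  using div_mod_less
  by (auto intro!: mat_eqI_index[of _ "d * n" "d * n"] kron_carrier simp: kron_index[of _ d d _ n n])

lemma kron_zero_right: "A \<in> carrier_mat d d \<Longrightarrow> kron A (0\<^sub>m n n) = 0\<^sub>m (d * n) (d * n)"
  using div_mod_less
  by (auto intro!: mat_eqI_index[of _ "d * n" "d * n"] kron_carrier simp: kron_index[of _ d d _ n n])

lemma spin_matrix_relations:
  assumes "1 \<le> g"
  shows "\<And>j. 1 \<le> j \<Longrightarrow> j \<le> g \<Longrightarrow>
      spin_matrix g j \<in> carrier_mat (2 ^ (g - 1)) (2 ^ (g - 1)) \<and>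
      sym_kernel (2 ^ (g - 1)) (entries (spin_matrix g j)) \<and>
      spin_matrix g j * spin_matrix g j = 1\<^sub>m (2 ^ (g - 1))"
    and "\<And>j k. 1 \<le> j \<Longrightarrow> j < k \<Longrightarrow> k \<le> g \<Longrightarrow>
      spin_matrix g j * spin_matrix g k + spin_matrix g k * spin_matrix g j =
        0\<^sub>m (2 ^ (g - 1)) (2 ^ (g - 1))"
  using assms
proof (induction g)
  case (Suc g)
  {
    case 1
    show ?case
    proof (cases "g = 0")
      case True
      then show ?thesis using 1 spin_matrix_base by (simp add: le_Suc_eq sym_kernel_def)
    next
      case False
      then have d: "2 * 2 ^ (g - 1) = (2 ^ g :: nat)" by (cases g) simp_all
      show ?thesis
      proof (cases "j = 1")
        case True
        have I: "sym_kernel (2 ^ (g - 1)) (entries (1\<^sub>m (2 ^ (g - 1))))"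
          by (simp add: sym_kernel_def)
        show ?thesis
          using True False
            kron_carrier[OF sigma_carrier(2), of "1\<^sub>m (2 ^ (g - 1))" "2 ^ (g - 1)" "2 ^ (g - 1)"]
            kron_sym_kernel[OF sigma_carrier(2) one_carrier_mat sigma_sym(1) I]
          by (simp add: spin_matrix_first[of g, simplified] kron_mult[of _ 2 _ _ "2 ^ (g - 1)"]
              sigma_carrier sigma_mult kron_one d d[simplified])
      next
        case j: False
        then obtain i where i: "j = Suc i" "1 \<le> i" "i \<le> g" using 1 by (cases j) auto
        have IH: "spin_matrix g i \<in> carrier_mat (2 ^ (g - 1)) (2 ^ (g - 1))"
          "sym_kernel (2 ^ (g - 1)) (entries (spin_matrix g i))"
          "spin_matrix g i * spin_matrix g i = 1\<^sub>m (2 ^ (g - 1))"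
          using Suc.IH(1)[of i] i False by auto
        show ?thesis
          using kron_carrier[OF sigma_carrier(3) IH(1)]
            kron_sym_kernel[OF sigma_carrier(3) IH(1) sigma_sym(2) IH(2)]
          by (simp add: i spin_matrix_later[OF i(2,3)] kron_mult[OF sigma_carrier(3,3) IH(1,1)] IH
              sigma_mult kron_one d d[simplified])
      qed
    qed
  next
    case 2
    then have g: "1 \<le> g" by simp
    then have d: "2 * 2 ^ (g - 1) = (2 ^ g :: nat)" by (cases g) simp_all
    obtain k' where k: "k = Suc k'" "1 \<le> k'" "k' \<le> g" using 2 by (cases k) auto
    have Pk: "spin_matrix g k' \<in> carrier_mat (2 ^ (g - 1)) (2 ^ (g - 1))"
      using Suc.IH(1)[of k'] k g by auto
    show ?case
    proof (cases "j = 1")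
      case True
      have "spin_matrix (Suc g) 1 * spin_matrix (Suc g) k + spin_matrix (Suc g) k * spin_matrix (Suc g) 1 =
          kron (sigma1 * sigma2 + sigma2 * sigma1) (spin_matrix g k')"
        by (simp add: k(1) spin_matrix_first[OF g] spin_matrix_later[OF k(2,3)]
            kron_mult[OF sigma_carrier(2,3) one_carrier_mat Pk]
            kron_mult[OF sigma_carrier(3,2) Pk one_carrier_mat]
            left_mult_one_mat[OF Pk] right_mult_one_mat[OF Pk]
            kron_add(2)[OF mult_carrier_mat[OF sigma_carrier(2,3)]
              mult_carrier_mat[OF sigma_carrier(3,2)] Pk Pk]
            del: One_nat_def)
      then show ?thesis
        using True kron_zero_left[OF Pk, of 2] by (simp add: sigma_mult d d[simplified])
    next
      case False
      then obtain j' where j: "j = Suc j'" "1 \<le> j'" "j' < k'" using 2 k by (cases j) auto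
      have Pj: "spin_matrix g j' \<in> carrier_mat (2 ^ (g - 1)) (2 ^ (g - 1))"
        using Suc.IH(1)[of j'] j k g by auto
      have "j' \<le> g" using j k by simp
      note later = spin_matrix_later[OF j(2) this] spin_matrix_later[OF k(2,3)]
      have "spin_matrix (Suc g) j * spin_matrix (Suc g) k + spin_matrix (Suc g) k * spin_matrix (Suc g) j =
          kron (1\<^sub>m 2) (spin_matrix g j' * spin_matrix g k' + spin_matrix g k' * spin_matrix g j')"
        by (simp add: j(1) k(1) later kron_mult[OF sigma_carrier(3,3) Pj Pk]
            kron_mult[OF sigma_carrier(3,3) Pk Pj] sigma_mult
            kron_add(1)[OF one_carrier_mat one_carrier_mat
              mult_carrier_mat[OF Pj Pk] mult_carrier_mat[OF Pk Pj]])
      also have "\<dots> = kron (1\<^sub>m 2) (0\<^sub>m (2 ^ (g - 1)) (2 ^ (g - 1)))"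
        using Suc.IH(2)[of j' k'] j k g by simp
      finally show ?thesis by (simp add: kron_zero_right[of _ 2] d d[simplified])
    qed
  }
qed simp_all

lemma spin_tuple_nth: "j < g \<Longrightarrow> spin_tuple g ! j = spin_matrix g (Suc j)"
  by (simp add: spin_tuple_def del: upt_Suc)

lemma spin_tuple_sym: "spin_tuple g \<in> sym_tuples g (2 ^ (g - 1))"
proof -
  have "spin_matrix g j \<in> carrier_mat (2 ^ (g - 1)) (2 ^ (g - 1)) \<and>
      transpose_mat (spin_matrix g j) = spin_matrix g j" if "1 \<le> j" "j \<le> g" for j
    using spin_matrix_relations(1)[of g j] that transpose_eq_iff_sym_kernel by auto
  then show ?thesis by (auto simp: sym_tuples_def spin_tuple_def simp del: upt_Suc)
qed

text \<open>
  The relations \<open>P\<^sub>j P\<^sub>k + P\<^sub>k P\<^sub>j = 2 \<delta>\<^sub>j\<^sub>k I\<close> in entries.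
\<close>

definition clifford_kernels :: "nat \<Rightarrow> nat \<Rightarrow> (nat \<Rightarrow> nat \<Rightarrow> nat \<Rightarrow> real) \<Rightarrow> bool" where
  "clifford_kernels g d P \<longleftrightarrow> (\<forall>j<g. sym_kernel d (P j)) \<and>
    (\<forall>j<g. \<forall>k<g. \<forall>b<d. \<forall>c<d. (\<Sum>a<d. P j b a * P k a c) + (\<Sum>a<d. P k b a * P j a c) =
       (if j = k \<and> b = c then 2 else 0))"

lemma clifford_spin_tuple: "clifford_kernels g (2 ^ (g - 1)) (\<lambda>j. entries (spin_tuple g ! j))"
  unfolding clifford_kernels_def
proof (intro conjI allI impI)
  fix j assume "j < g"
  then show "sym_kernel (2 ^ (g - 1)) (entries (spin_tuple g ! j))"
    by (rule sym_tuples_nth(3)[OF spin_tuple_sym])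
next
  fix j k b c :: nat
  define d :: nat where "d = 2 ^ (g - 1)"
  assume *: "j < g" "k < g" "b < 2 ^ (g - 1)" "c < 2 ^ (g - 1)"
  then have bc: "b < d" "c < d" by (simp_all add: d_def)
  define p where "p j = spin_tuple g ! j" for j
  have g: "1 \<le> g" using * by simp
  have c: "p j \<in> carrier_mat d d" if "j < g" for j
    using sym_tuples_nth(1)[OF spin_tuple_sym that] by (simp add: d_def p_def)
  have prod: "(p j * p k) $$ (b, c) = (\<Sum>a<d. p j $$ (b, a) * p k $$ (a, c))"
    if "j < g" "k < g" for j k
    by (rule mult_index_sum[OF c[OF that(1)] c[OF that(2)] bc])
  have anti: "(p j * p k) $$ (b, c) + (p k * p j) $$ (b, c) = 0" if "j < k" "k < g" for j k
  proof -
    have "p j * p k + p k * p j = 0\<^sub>m d d"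
      using spin_matrix_relations(2)[OF g, of "Suc j" "Suc k"] that
      by (simp add: spin_tuple_nth p_def d_def)
    then have "(p j * p k + p k * p j) $$ (b, c) = 0" using bc by simp
    then show ?thesis using bc c[of j] c[of k] that by simp
  qed
  have "(p j * p k) $$ (b, c) + (p k * p j) $$ (b, c) = (if j = k \<and> b = c then 2 else 0)"
  proof (cases j k rule: linorder_cases)
    case equal
    have "p j * p j = 1\<^sub>m d"
      using spin_matrix_relations(1)[OF g, of "Suc j"] * by (simp add: spin_tuple_nth p_def d_def)
    then show ?thesis using equal bc by simp
  next
    case less
    then show ?thesis using anti[of j k] * by simp
  next
    case greater
    then show ?thesis using anti[of k j] * by simp
  qed
  then show "(\<Sum>a<2 ^ (g - 1). spin_tuple g ! j $$ (b, a) * spin_tuple g ! k $$ (a, c)) +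
      (\<Sum>a<2 ^ (g - 1). spin_tuple g ! k $$ (b, a) * spin_tuple g ! j $$ (a, c)) =
      (if j = k \<and> b = c then 2 else 0)"
    using prod * by (simp add: p_def d_def)
qed

text \<open>
  Since \<open>P\<^sub>j\<^sup>2 = I\<close>, the vector \<open>\<Sum>\<^sub>a e\<^sub>a \<otimes> e\<^sub>a\<close> of squared length \<open>d\<close> is fixed by every \<open>P\<^sub>j \<otimes> P\<^sub>j\<close>, whose
  quadratic form there is the sum below. The \<open>g\<close> matrices thus add up to the eigenvalue \<open>g\<close>, which makes
  that constant unavoidable.
\<close>

lemma clifford_square_trace:
  assumes "clifford_kernels g d P" "j < g"
  shows "(\<Sum>a<d. \<Sum>b<d. P j a b * P j a b) = real d"
proof -
  have "(\<Sum>b<d. P j a b * P j a b) = 1" if "a < d" for a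
  proof -
    have "(\<Sum>b<d. P j a b * P j a b) = (\<Sum>b<d. P j a b * P j b a)"
      using assms that by (intro sum.cong refl) (simp add: clifford_kernels_def sym_kernel_def)
    then show ?thesis using assms that by (force simp: clifford_kernels_def)
  qed
  then show ?thesis by simp
qed

section \<open>Consequences of the Clifford relations\<close>

lemma ip_sum_left: "ip n (\<lambda>i. \<Sum>s\<in>S. f s i) y = (\<Sum>s\<in>S. ip n (f s) y)"
  unfolding ip_def sum_distrib_right by (rule sum.swap)

lemma ip_sum_right: "ip n y (\<lambda>i. \<Sum>s\<in>S. f s i) = (\<Sum>s\<in>S. ip n y (f s))"
  unfolding ip_commute[of n y] by (rule ip_sum_left)

text \<open>
  For commuting symmetric \<open>T\<^sub>j\<close> one has \<open>(\<Sum>\<^sub>j P\<^sub>j \<otimes> T\<^sub>j)\<^sup>2 = I \<otimes> \<Sum>\<^sub>j T\<^sub>j\<^sup>2\<close>: in the double sum over \<open>j\<close> and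
  \<open>k\<close> the factors \<open>T\<^sub>j T\<^sub>k\<close> are symmetric, so only the anticommutators of the \<open>P\<^sub>j\<close> survive. The lemma
  is this identity evaluated as a quadratic form at the vector with blocks \<open>u\<close>.
\<close>

lemma clifford_isometry:
  fixes u :: "nat \<Rightarrow> nat \<Rightarrow> real"
  assumes P: "clifford_kernels g d P"
    and sym: "\<And>j. j < g \<Longrightarrow> sym_kernel N (T j)"
    and comm: "\<And>i j. i < g \<Longrightarrow> j < g \<Longrightarrow> commute_on N (T i) (T j)"
  defines "y \<equiv> \<lambda>a i. \<Sum>j<g. \<Sum>b<d. P j a b * mv N (T j) (u b) i"
  shows "(\<Sum>a<d. ip N (y a) (y a)) = (\<Sum>j<g. \<Sum>b<d. ip N (mv N (T j) (u b)) (mv N (T j) (u b)))"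
proof -
  define G where "G j b k c = ip N (mv N (T j) (u b)) (mv N (T k) (u c))" for j b k c
  define Q where "Q j k b c = (\<Sum>a<d. P j b a * P k a c)" for j k b c
  have G_swap: "G j b k c = G k b j c" if "j < g" "k < g" for j k b c
  proof -
    have "G j b k c = ip N (u b) (mv N (T j) (mv N (T k) (u c)))"
      using ip_mv_sym[OF sym[OF that(1)], of "mv N (T k) (u c)" "u b"] by (simp add: G_def ip_commute)
    also have "\<dots> = ip N (u b) (mv N (T k) (mv N (T j) (u c)))"
      using comm[OF that] by (intro ip_cong) (simp_all add: commute_on_def)
    also have "\<dots> = G k b j c"
      using ip_mv_sym[OF sym[OF that(2)], of "mv N (T j) (u c)" "u b"] by (simp add: G_def ip_commute)
    finally show ?thesis .
  qed
  have "ip N (y a) (y a) = (\<Sum>j<g. \<Sum>b<d. \<Sum>k<g. \<Sum>c<d. P j a b * P k a c * G j b k c)" for a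
    unfolding y_def unfolding ip_sum_left unfolding ip_sum_right
    by (simp add: ip_scale_left ip_scale_right G_def mult.assoc)
  then have "(\<Sum>a<d. ip N (y a) (y a)) =
      (\<Sum>a<d. \<Sum>j<g. \<Sum>b<d. \<Sum>k<g. \<Sum>c<d. P j a b * P k a c * G j b k c)" by simp
  also have "\<dots> = (\<Sum>j<g. \<Sum>b<d. \<Sum>k<g. \<Sum>c<d. \<Sum>a<d. P j a b * P k a c * G j b k c)"
    by ((rule trans[OF sum.swap], rule sum.cong[OF refl])+, rule refl)
  also have "\<dots> = (\<Sum>j<g. \<Sum>b<d. \<Sum>k<g. \<Sum>c<d. Q j k b c * G j b k c)"
    unfolding Q_def sum_distrib_right
    using P by (intro sum.cong refl) (auto simp: clifford_kernels_def sym_kernel_def)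
  also have "\<dots> = (\<Sum>j<g. \<Sum>k<g. \<Sum>b<d. \<Sum>c<d. Q j k b c * G j b k c)"
    by (rule sum.cong[OF refl], rule sum.swap)
  finally have total: "(\<Sum>a<d. ip N (y a) (y a)) =
      (\<Sum>j<g. \<Sum>k<g. \<Sum>b<d. \<Sum>c<d. Q j k b c * G j b k c)" .
  \<comment> \<open>Renaming \<open>j\<close> and \<open>k\<close> and using the symmetry of \<open>G\<close> replaces \<open>P\<^sub>j P\<^sub>k\<close> by \<open>P\<^sub>k P\<^sub>j\<close>.\<close>
  have swapped: "(\<Sum>j<g. \<Sum>k<g. \<Sum>b<d. \<Sum>c<d. Q j k b c * G j b k c) =
      (\<Sum>j<g. \<Sum>k<g. \<Sum>b<d. \<Sum>c<d. Q k j b c * G j b k c)"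
    by (subst sum.swap) (intro sum.cong refl; simp add: G_swap)
  have "2 * (\<Sum>a<d. ip N (y a) (y a)) =
      (\<Sum>j<g. \<Sum>k<g. \<Sum>b<d. \<Sum>c<d. Q j k b c * G j b k c) +
      (\<Sum>j<g. \<Sum>k<g. \<Sum>b<d. \<Sum>c<d. Q k j b c * G j b k c)"
    using total swapped by simp
  also have "\<dots> = (\<Sum>j<g. \<Sum>k<g. \<Sum>b<d. \<Sum>c<d. (Q j k b c + Q k j b c) * G j b k c)"
    by (simp add: distrib_right sum.distrib)
  also have "\<dots> = (\<Sum>j<g. \<Sum>k<g. \<Sum>b<d. \<Sum>c<d. if k = j then (if c = b then 2 * G j b k c else 0) else 0)"
    using P by (intro sum.cong refl) (simp add: clifford_kernels_def Q_def)
  also have "\<dots> = (\<Sum>j<g. \<Sum>b<d. 2 * G j b j b)"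
  proof (rule sum.cong[OF refl])
    fix j assume "j \<in> {..<g}"
    have "(\<Sum>k<g. \<Sum>b<d. \<Sum>c<d. if k = j then (if c = b then 2 * G j b k c else 0) else 0) =
      (\<Sum>k<g. if k = j then (\<Sum>b<d. \<Sum>c<d. if c = b then 2 * G j b k c else 0) else 0)"
      by (intro sum.cong refl) simp
    then show "(\<Sum>k<g. \<Sum>b<d. \<Sum>c<d. if k = j then (if c = b then 2 * G j b k c else 0) else 0) =
      (\<Sum>b<d. 2 * G j b j b)"
      using \<open>j \<in> _\<close> by simp
  qed
  also have "\<dots> = 2 * (\<Sum>j<g. \<Sum>b<d. G j b j b)" by (simp add: sum_distrib_left)
  finally show ?thesis by (simp add: G_def)
qed

text \<open>
  By the previous identity \<open>\<Sum>\<^sub>j P\<^sub>j \<otimes> T\<^sub>j\<close> has square at most \<open>R\<^sup>2\<close>, hence is at most \<open>R\<close>; the passage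
  from the square is Young's inequality between the vectors \<open>R u\<close> and \<open>(\<Sum>\<^sub>j P\<^sub>j \<otimes> T\<^sub>j) u\<close>.
\<close>

lemma commuting_spin_inequality:
  assumes P: "clifford_kernels g d P"
    and sym: "\<And>j. j < g \<Longrightarrow> sym_kernel N (T j)"
    and comm: "\<And>i j. i < g \<Longrightarrow> j < g \<Longrightarrow> commute_on N (T i) (T j)"
    and R: "0 < R" "\<And>w. (\<Sum>j<g. ip N (mv N (T j) w) (mv N (T j) w)) \<le> R * R * ip N w w"
  shows "(\<Sum>j<g. \<Sum>a<d. \<Sum>b<d. P j a b * ip N (u a) (mv N (T j) (u b))) \<le> R * (\<Sum>a<d. ip N (u a) (u a))"
proof -
  define y where "y = (\<lambda>a i. \<Sum>j<g. \<Sum>b<d. P j a b * mv N (T j) (u b) i)"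
  have "(\<Sum>j<g. \<Sum>a<d. \<Sum>b<d. P j a b * ip N (u a) (mv N (T j) (u b))) =
      (\<Sum>a<d. \<Sum>j<g. \<Sum>b<d. P j a b * ip N (u a) (mv N (T j) (u b)))"
    by (rule sum.swap)
  also have "\<dots> = (\<Sum>a<d. ip N (u a) (y a))"
    by (simp add: y_def ip_sum_right ip_scale_right)
  also have "2 * R * \<dots> \<le> R * R * (\<Sum>a<d. ip N (u a) (u a)) + (\<Sum>a<d. ip N (y a) (y a))"
  proof -
    have "2 * R * ip N (u a) (y a) \<le> R * R * ip N (u a) (u a) + ip N (y a) (y a)" for a
      using ip_young[of N "\<lambda>i. R * u a i" "y a"] by (simp add: ip_scale_left ip_scale_right)
    then show ?thesis
      unfolding sum_distrib_left sum.distrib[symmetric] by (intro sum_mono) simp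
  qed
  also have "(\<Sum>a<d. ip N (y a) (y a)) = (\<Sum>j<g. \<Sum>b<d. ip N (mv N (T j) (u b)) (mv N (T j) (u b)))"
    unfolding y_def using P sym comm by (rule clifford_isometry)
  also have "\<dots> = (\<Sum>b<d. \<Sum>j<g. ip N (mv N (T j) (u b)) (mv N (T j) (u b)))"
    by (rule sum.swap)
  also have "\<dots> \<le> R * R * (\<Sum>a<d. ip N (u a) (u a))"
    unfolding sum_distrib_left by (intro sum_mono R(2))
  finally show ?thesis using R(1) by simp
qed

lemma transpose_smult_mat: "transpose_mat (c \<cdot>\<^sub>m M) = c \<cdot>\<^sub>m transpose_mat M"
  by (intro eq_matI) auto

lemma scale_tuple_sym: "X \<in> sym_tuples g n \<Longrightarrow> scale_tuple c X \<in> sym_tuples g n"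
  by (auto simp: sym_tuples_def scale_tuple_def transpose_smult_mat)

lemma scale_tuple_nth: "X \<in> sym_tuples g n \<Longrightarrow> j < g \<Longrightarrow> scale_tuple c X ! j = c \<cdot>\<^sub>m X ! j"
  by (auto simp: sym_tuples_def scale_tuple_def)

text \<open>
  \<open>P\<^sub>j\<close> is a symmetric involution, so \<open>P\<^sub>j \<otimes> I\<close> preserves lengths, and \<open>P\<^sub>j \<otimes> M\<close> is a contraction
  whenever \<open>M\<close> is one.
\<close>

lemma spin_matrix_contraction:
  assumes P: "clifford_kernels g d P" "j < g"
    and M: "sym_kernel n M" "\<And>x. \<bar>ip n x (mv n M x)\<bar> \<le> ip n x x"
  shows "(\<Sum>a<d. \<Sum>b<d. P j a b * ip n (u a) (mv n M (u b))) \<le> (\<Sum>a<d. ip n (u a) (u a))"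
proof -
  define y where "y a i = (\<Sum>b<d. P j a b * u b i)" for a i
  have yy: "(\<Sum>a<d. ip n (y a) (y a)) = (\<Sum>a<d. ip n (u a) (u a))"
  proof -
    have "(\<Sum>a<d. ip n (y a) (y a)) = (\<Sum>a<d. \<Sum>b<d. \<Sum>c<d. P j a b * P j a c * ip n (u b) (u c))"
      unfolding y_def[abs_def] unfolding ip_sum_left unfolding ip_sum_right
      by (simp add: ip_scale_left ip_scale_right mult.assoc)
    also have "\<dots> = (\<Sum>b<d. \<Sum>c<d. \<Sum>a<d. P j a b * P j a c * ip n (u b) (u c))"
      by (subst sum.swap, rule sum.cong[OF refl], subst sum.swap, rule refl)
    also have "\<dots> = (\<Sum>b<d. \<Sum>c<d. if c = b then ip n (u b) (u c) else 0)"
    proof (intro sum.cong refl)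
      fix b c assume bc: "b \<in> {..<d}" "c \<in> {..<d}"
      have "(\<Sum>a<d. P j a b * P j a c) = (\<Sum>a<d. P j b a * P j a c)"
        using P bc by (intro sum.cong refl) (simp add: clifford_kernels_def sym_kernel_def)
      also have "\<dots> = (if c = b then 1 else 0)"
        using P bc by (force simp: clifford_kernels_def)
      finally show "(\<Sum>a<d. P j a b * P j a c * ip n (u b) (u c)) = (if c = b then ip n (u b) (u c) else 0)"
        by (simp add: sum_distrib_right[symmetric])
    qed
    finally show ?thesis by simp
  qed
  have mvy: "mv n M (y a) i = (\<Sum>b<d. P j a b * mv n M (u b) i)" for a i
  proof -
    have "mv n M (y a) i = (\<Sum>k<n. \<Sum>b<d. P j a b * (M i k * u b k))"
      by (simp add: mv_def y_def sum_distrib_left algebra_simps)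
    also have "\<dots> = (\<Sum>b<d. \<Sum>k<n. P j a b * (M i k * u b k))" by (rule sum.swap)
    finally show ?thesis by (simp add: mv_def sum_distrib_left)
  qed
  then have My: "mv n M (y a) = (\<lambda>i. \<Sum>b<d. P j a b * mv n M (u b) i)" for a
    by blast
  have "2 * (\<Sum>a<d. \<Sum>b<d. P j a b * ip n (u a) (mv n M (u b))) = (\<Sum>a<d. 2 * ip n (u a) (mv n M (y a)))"
    by (simp add: My ip_sum_right ip_scale_right sum_distrib_left)
  also have "\<dots> \<le> (\<Sum>a<d. ip n (u a) (u a) + ip n (y a) (y a))"
    using bilinear_bound[OF M(1), of 1] M(2) by (intro sum_mono) simp
  finally show ?thesis by (simp add: sum.distrib yy)
qed

section \<open>The min ball and the spin ball\<close>

lemma sum_mult_delta: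
  fixes f :: "nat \<Rightarrow> real"
  assumes "j < g"
  shows "(\<Sum>k<g. f k * (if k = j then c else 0)) = f j * c"
    and "(\<Sum>k<g. (if k = j then c else 0) * f k) = c * f j"
proof -
  have "(\<Sum>k<g. f k * (if k = j then c else 0)) = (\<Sum>k<g. if k = j then f k * c else 0)"
    by (intro sum.cong) auto
  then show "(\<Sum>k<g. f k * (if k = j then c else 0)) = f j * c" using assms by simp
  then show "(\<Sum>k<g. (if k = j then c else 0) * f k) = c * f j" by (simp add: mult.commute)
qed

text \<open>
  Unit vectors \<open>\<plusminus> e\<^sub>j\<close> show that each \<open>X\<^sub>j\<close> is a contraction; then each of the \<open>g\<close> summands
  \<open>P\<^sub>j \<otimes> X\<^sub>j\<close> is at most \<open>I\<close>.
\<close>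

lemma min_ball_subset_spin_ball:
  assumes "1 \<le> g"
  shows "levelwise_subset (min_ball g) (scaled (real g) (spin_ball g))"
  unfolding levelwise_subset_def
proof (intro allI impI subsetI)
  fix n X assume X: "X \<in> min_ball g n"
  then have Xs: "X \<in> sym_tuples g n" by (simp add: min_ball_iff)
  note X' = sym_tuples_nth[OF Xs]
  let ?d = "2 ^ (g - 1) :: nat"
  define Y where "Y = scale_tuple (1 / real g) X"
  have "\<bar>ip n x (mv n (entries (X ! j)) x)\<bar> \<le> ip n x x" if "j < g" for j x
  proof -
    have "c * ip n x (mv n (entries (X ! j)) x) \<le> ip n x x" if "c * c = 1" for c
    proof -
      have "(\<Sum>k<g. (if k = j then c else 0) * (if k = j then c else 0)) = 1"
        using \<open>j < g\<close> that by (subst sum_mult_delta) simp_all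
      then have "(\<Sum>k<g. (if k = j then c else 0) * ip n x (mv n (entries (X ! k)) x)) \<le> ip n x x"
        using X by (simp only: min_ball_iff)
      then show ?thesis
        by (simp only: sum_mult_delta(2)[OF \<open>j < g\<close>, of c "\<lambda>k. ip n x (mv n (entries (X ! k)) x)"])
    qed
    from this[of 1] this[of "-1"] show ?thesis by simp
  qed
  then have each: "(\<Sum>a<?d. \<Sum>b<?d. spin_tuple g ! j $$ (a, b) * ip n (u a) (mv n (entries (X ! j)) (u b)))
      \<le> (\<Sum>a<?d. ip n (u a) (u a))" if "j < g" for u j
    using spin_matrix_contraction[OF clifford_spin_tuple that X'(3)[OF that]] that by blast
  have "(\<Sum>j<g. \<Sum>a<?d. \<Sum>b<?d. spin_tuple g ! j $$ (a, b) * ip n (u a) (mv n (entries (Y ! j)) (u b)))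
      \<le> (\<Sum>a<?d. ip n (u a) (u a))" for u
  proof -
    have "(\<Sum>j<g. \<Sum>a<?d. \<Sum>b<?d. spin_tuple g ! j $$ (a, b) * ip n (u a) (mv n (entries (Y ! j)) (u b))) =
      (1 / real g) * (\<Sum>j<g. \<Sum>a<?d. \<Sum>b<?d. spin_tuple g ! j $$ (a, b) * ip n (u a) (mv n (entries (X ! j)) (u b)))"
      unfolding sum_distrib_left
      by (intro sum.cong refl) (simp add: Y_def scale_tuple_nth[OF Xs] ip_mv_smult[OF X'(1)])
    also have "\<dots> \<le> (1 / real g) * (\<Sum>j<g. \<Sum>a<?d. ip n (u a) (u a))"
      using each by (intro mult_left_mono sum_mono[of "{..<g}"]) auto
    finally show ?thesis using assms by simp
  qed
  then have "Y \<in> spin_ball g n"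
    unfolding spin_ball_def free_spectrahedron_iff[OF spin_tuple_sym]
    using scale_tuple_sym[OF Xs] by (simp add: Y_def)
  moreover have "X = scale_tuple (real g) Y"
    using assms by (auto simp: Y_def scale_tuple_def o_def
        intro!: nth_equalityI eq_matI)
  ultimately show "X \<in> scaled (real g) (spin_ball g) n" by (simp add: scaled_def)
qed

text \<open>
  \<open>\<Sum>\<^sub>j c\<^sub>j P\<^sub>j\<close> has square \<open>|c|\<^sup>2 I\<close>: the case of \<open>1 \<times> 1\<close> matrices \<open>T\<^sub>j = c\<^sub>j\<close> of the inequality for
  commuting tuples.
\<close>

lemma clifford_linear_bound:
  assumes "clifford_kernels g d P" "(\<Sum>j<g. c j * c j) \<le> 1"
  shows "(\<Sum>j<g. c j * ip d x (mv d (P j) x)) \<le> ip d x x"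
proof -
  have "(\<Sum>j<g. \<Sum>a<d. \<Sum>b<d. P j a b * ip 1 (\<lambda>i. x a) (mv 1 (\<lambda>i k. c j) (\<lambda>i. x b)))
      \<le> 1 * (\<Sum>a<d. ip 1 (\<lambda>i. x a) (\<lambda>i. x a))"
  proof (rule commuting_spin_inequality[OF assms(1)])
    fix w :: "nat \<Rightarrow> real"
    have "(\<Sum>j<g. c j * c j) * (w 0 * w 0) \<le> 1 * (w 0 * w 0)"
      using assms(2) by (intro mult_right_mono) auto
    then show "(\<Sum>j<g. ip 1 (mv 1 (\<lambda>i k. c j) w) (mv 1 (\<lambda>i k. c j) w)) \<le> 1 * 1 * ip 1 w w"
      by (simp add: ip_def mv_def sum_distrib_left algebra_simps)
  qed (auto simp: sym_kernel_def commute_on_def mv_def)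
  then show ?thesis
    by (simp add: ip_def mv_def sum_distrib_left algebra_simps)
qed

lemma ip_unit: "a < n \<Longrightarrow> ip n (\<lambda>i. if i = a then 1 else 0) y = y a"
  by (simp only: ip_def sum_mult_delta(2) mult_1_left)

lemma mv_unit: "b < n \<Longrightarrow> mv n M (\<lambda>i. if i = b then 1 else 0) = (\<lambda>i. M i b)"
  by (simp only: mv_def sum_mult_delta(1) mult_1_right)

lemma spin_tuple_mem_min_ball: "spin_tuple g \<in> min_ball g (2 ^ (g - 1))"
  unfolding min_ball_iff using spin_tuple_sym clifford_linear_bound[OF clifford_spin_tuple]
  by auto

text \<open>
  The spin tuple is an extremal element of the min ball. If \<open>P = \<rho> Y\<close> with \<open>Y\<close> in the spin ball,
  the inequality for \<open>Y\<close> at \<open>\<Sum>\<^sub>a e\<^sub>a \<otimes> e\<^sub>a\<close>, multiplied by \<open>\<rho>\<close>, reads \<open>g d \<le> \<rho> d\<close>.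
\<close>

lemma min_ball_subset_spin_ball_sharp:
  assumes "0 \<le> \<rho>" and sub: "levelwise_subset (min_ball g) (scaled \<rho> (spin_ball g))"
  shows "real g \<le> \<rho>"
proof -
  define d :: nat where "d = 2 ^ (g - 1)"
  have d: "1 \<le> d" by (simp add: d_def)
  have "spin_tuple g \<in> scaled \<rho> (spin_ball g) d"
    using spin_tuple_mem_min_ball[of g, folded d_def] sub d unfolding levelwise_subset_def by blast
  then obtain Y where Y: "Y \<in> spin_ball g d" "spin_tuple g = scale_tuple \<rho> Y"
    by (auto simp: scaled_def)
  then have Ys: "Y \<in> sym_tuples g d"
    and ineq: "\<And>u. (\<Sum>j<g. \<Sum>a<d. \<Sum>b<d. spin_tuple g ! j $$ (a, b) * ip d (u a) (mv d (entries (Y ! j)) (u b)))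
      \<le> (\<Sum>a<d. ip d (u a) (u a))"
    unfolding spin_ball_def free_spectrahedron_iff[OF spin_tuple_sym] by (simp_all add: d_def)
  have P: "spin_tuple g ! j $$ (a, b) = \<rho> * Y ! j $$ (a, b)" if "j < g" "a < d" "b < d" for j a b
    using that sym_tuples_nth(1)[OF Ys that(1)] by (simp add: Y(2) scale_tuple_nth[OF Ys])
  have sum: "(\<Sum>j<g. \<Sum>a<d. \<Sum>b<d. spin_tuple g ! j $$ (a, b) * spin_tuple g ! j $$ (a, b)) = real g * real d"
    using clifford_square_trace[OF clifford_spin_tuple, of _ g] by (simp add: d_def)
  have "(\<Sum>j<g. \<Sum>a<d. \<Sum>b<d. spin_tuple g ! j $$ (a, b) * Y ! j $$ (a, b)) \<le> real d"
    using ineq[of "\<lambda>a i. if i = a then 1 else 0"] by (simp add: ip_unit mv_unit cong: sum.cong_simp)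
  then have "\<rho> * (\<Sum>j<g. \<Sum>a<d. \<Sum>b<d. spin_tuple g ! j $$ (a, b) * Y ! j $$ (a, b)) \<le> \<rho> * real d"
    using assms(1) by (rule mult_left_mono)
  moreover have "\<rho> * (\<Sum>j<g. \<Sum>a<d. \<Sum>b<d. spin_tuple g ! j $$ (a, b) * Y ! j $$ (a, b)) = real g * real d"
    unfolding sum[symmetric] sum_distrib_left
    by (intro sum.cong refl) (simp add: P algebra_simps)
  ultimately have "real g * real d \<le> \<rho> * real d" by simp
  then show ?thesis using d by simp
qed

section \<open>The dilation with constant \<open>g\<close>\<close>

abbreviation qform :: "nat \<Rightarrow> real mat \<Rightarrow> (nat \<Rightarrow> real) \<Rightarrow> real" where
  "qform n M x \<equiv> ip n x (mv n (entries M) x)"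

lemma coordinate_tuple_nth:
  "j < g \<Longrightarrow> k < g \<Longrightarrow> coordinate_tuple g n j M ! k = (if k = j then M else 0\<^sub>m n n)"
  by (simp add: coordinate_tuple_def nth_list_update)

lemma coordinate_tuple_sym:
  assumes "M \<in> carrier_mat n n" "transpose_mat M = M"
  shows "coordinate_tuple g n j M \<in> sym_tuples g n"
proof -
  have "set ((replicate g (0\<^sub>m n n))[j := M]) \<subseteq> insert M (set (replicate g (0\<^sub>m n n)))"
    by (rule set_update_subset_insert)
  then show ?thesis
    using assms by (auto simp: sym_tuples_def coordinate_tuple_def split: if_splits)
qed

lemma ip_mv_zero_mat: "ip n x (mv n (entries (0\<^sub>m n n)) y) = 0"
  by (simp add: ip_def mv_def)

lemma form_index:
  assumes "T \<in> carrier_mat N N" "V \<in> carrier_mat N n" "a < n" "b < n"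
  shows "(transpose_mat V * T * V) $$ (a, b) = ip N (\<lambda>r. V $$ (r, a)) (mv N (entries T) (\<lambda>r. V $$ (r, b)))"
proof -
  have V': "transpose_mat V \<in> carrier_mat n N" using assms by simp
  have "(transpose_mat V * T * V) $$ (a, b) = (transpose_mat V * (T * V)) $$ (a, b)"
    using assoc_mult_mat[OF V' assms(1,2)] by simp
  also have "\<dots> = (\<Sum>r<N. transpose_mat V $$ (a, r) * (T * V) $$ (r, b))"
    by (rule mult_index_sum[OF V' mult_carrier_mat[OF assms(1,2)] assms(3,4)])
  also have "\<dots> = (\<Sum>r<N. V $$ (r, a) * (\<Sum>s<N. T $$ (r, s) * V $$ (s, b)))"
    using assms by (intro sum.cong refl arg_cong2[of _ _ _ _ "(*)"])
      (simp_all add: mult_index_sum[OF assms(1,2) _ assms(4)] del: index_mult_mat(1))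
  finally show ?thesis by (simp add: ip_def mv_def)
qed

lemma gram_index:
  assumes "V \<in> carrier_mat N n" "a < n" "b < n"
  shows "(transpose_mat V * V) $$ (a, b) = ip N (\<lambda>r. V $$ (r, a)) (\<lambda>r. V $$ (r, b))"
  using assms by (subst mult_index_sum[of _ n N _ n]) (auto simp: ip_def)

text \<open>
  In terms of the columns \<open>u a\<close> of the isometry, a dilation expresses the entries of \<open>C\<^sub>j\<close> as values of
  the bilinear form of \<open>\<rho> T\<^sub>j\<close>.
\<close>

lemma dilates_to_forms:
  assumes T: "T \<in> sym_tuples g N" and "dilates_to n C N (scale_tuple \<rho> T)" "length C = g"
  obtains u where "\<And>a. a < n \<Longrightarrow> ip N (u a) (u a) = 1"
    "\<And>j a b. j < g \<Longrightarrow> a < n \<Longrightarrow> b < n \<Longrightarrow>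
      C ! j $$ (a, b) = \<rho> * ip N (u a) (mv N (entries (T ! j)) (u b))"
proof -
  obtain V where V: "V \<in> carrier_mat N n" "transpose_mat V * V = 1\<^sub>m n"
    "\<And>j. j < g \<Longrightarrow> C ! j = transpose_mat V * scale_tuple \<rho> T ! j * V"
    using assms by (auto simp: dilates_to_def)
  have "ip N (\<lambda>r. V $$ (r, a)) (\<lambda>r. V $$ (r, a)) = 1" if "a < n" for a
    using gram_index[OF V(1) that that] V(2) that by simp
  moreover have "C ! j $$ (a, b) = \<rho> * ip N (\<lambda>r. V $$ (r, a)) (mv N (entries (T ! j)) (\<lambda>r. V $$ (r, b)))"
    if "j < g" "a < n" "b < n" for j a b
    using sym_tuples_nth(1)[OF T that(1)] form_index[of "\<rho> \<cdot>\<^sub>m T ! j" N V n a b] V that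
    by (simp add: scale_tuple_nth[OF T] ip_mv_smult del: index_mult_mat(1))
  ultimately show thesis using that[of "\<lambda>a r. V $$ (r, a)"] by blast
qed

lemma commuting_tuple_commute_on:
  assumes "T \<in> sym_tuples g N" "commuting_tuple T" "i < g" "j < g"
  shows "commute_on N (entries (T ! i)) (entries (T ! j))"
proof (rule commute_onI)
  fix p q assume pq: "p < N" "q < N"
  note c = sym_tuples_nth(1)[OF assms(1)]
  have "T ! i * T ! j = T ! j * T ! i"
    using assms by (auto simp: commuting_tuple_def sym_tuples_length)
  then show "(\<Sum>l<N. T ! i $$ (p, l) * T ! j $$ (l, q)) = (\<Sum>l<N. T ! j $$ (p, l) * T ! i $$ (l, q))"
    using mult_index_sum[OF c[OF assms(3)] c[OF assms(4)] pq]
      mult_index_sum[OF c[OF assms(4)] c[OF assms(3)] pq] by simp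
qed

text \<open>
  Different members live on different diagonal blocks, so they annihilate each other.
\<close>

definition block_tuple :: "nat \<Rightarrow> nat \<Rightarrow> real mat list \<Rightarrow> real mat list" where
  "block_tuple g n C = map (\<lambda>j. mat (g * n) (g * n) (\<lambda>(p, q).
     if p div n = j \<and> q div n = j then C ! j $$ (p mod n, q mod n) else 0)) [0..<g]"

lemma block_tuple_sym:
  assumes "C \<in> sym_tuples g n"
  shows "block_tuple g n C \<in> sym_tuples g (g * n)"
proof -
  have "C ! j $$ (p mod n, q mod n) = C ! j $$ (q mod n, p mod n)"
    if "j < g" "p < g * n" "q < g * n" for j p q
    using sym_tuples_nth(3)[OF assms that(1)] div_mod_less(2)[OF that(2)] div_mod_less(2)[OF that(3)]
    by (simp add: sym_kernel_def)
  then show ?thesis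
    by (auto simp: sym_tuples_def block_tuple_def intro!: eq_matI)
qed

lemma block_tuple_form:
  assumes "j < g"
  shows "ip (g * n) x (mv (g * n) (entries (block_tuple g n C ! j)) y) =
    ip n (\<lambda>i. x (j * n + i)) (mv n (entries (C ! j)) (\<lambda>i. y (j * n + i)))"
proof -
  let ?B = "block_tuple g n C ! j"
  have B: "?B $$ (a * n + i, b * n + k) = (if a = j \<and> b = j then C ! j $$ (i, k) else 0)"
    if "a < g" "b < g" "i < n" "k < n" for a b i k
    using assms that block_index_less[of a g i n] block_index_less[of b g k n]
    by (simp add: block_tuple_def)
  have "mv (g * n) (entries ?B) y (a * n + i) =
      (if a = j then mv n (entries (C ! j)) (\<lambda>k. y (j * n + k)) i else 0)"
    if "a < g" "i < n" for a i
  proof -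
    have "mv (g * n) (entries ?B) y (a * n + i) =
        (\<Sum>b<g. \<Sum>k<n. ?B $$ (a * n + i, b * n + k) * y (b * n + k))"
      by (simp add: mv_def sum_lessThan_mult)
    also have "\<dots> = (\<Sum>b<g. if b = j then
        (if a = j then mv n (entries (C ! j)) (\<lambda>k. y (j * n + k)) i else 0) else 0)"
      using that by (intro sum.cong[OF refl]) (simp add: B mv_def)
    finally show ?thesis using assms by simp
  qed
  then have "ip (g * n) x (mv (g * n) (entries ?B) y) =
     (\<Sum>a<g. if a = j then
       ip n (\<lambda>i. x (j * n + i)) (mv n (entries (C ! j)) (\<lambda>i. y (j * n + i))) else 0)"
    unfolding ip_def[of "g * n"] sum_lessThan_mult
    by (intro sum.cong[OF refl]) (simp add: ip_def)
  then show ?thesis using assms by simp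
qed

lemma block_tuple_commuting: "commuting_tuple (block_tuple g n C)"
proof -
  define B where "B j = mat (g * n) (g * n) (\<lambda>(p, q).
     if p div n = j \<and> q div n = j then C ! j $$ (p mod n, q mod n) else 0)" for j
  have B: "B j \<in> carrier_mat (g * n) (g * n)" for j by (simp add: B_def)
  have zero: "B i * B j = 0\<^sub>m (g * n) (g * n)" if "i \<noteq> j" for i j
  proof (rule mat_eqI_index[OF mult_carrier_mat[OF B B] zero_carrier_mat])
    fix p q assume pq: "p < g * n" "q < g * n"
    have "(\<Sum>r<g * n. B i $$ (p, r) * B j $$ (r, q)) = 0"
      using pq that by (intro sum.neutral) (auto simp: B_def)
    then show "(B i * B j) $$ (p, q) = 0\<^sub>m (g * n) (g * n) $$ (p, q)"
      using pq mult_index_sum[OF B B pq] by simp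
  qed
  have "B i * B j = B j * B i" for i j using zero[of i j] zero[of j i] by (cases "i = j") auto
  then show ?thesis by (auto simp: commuting_tuple_def block_tuple_def B_def[symmetric])
qed

text \<open>
  The isometry sends \<open>x\<close> to \<open>(x, \<dots>, x) / sqrt g\<close>; the compression of the \<open>j\<close>-th matrix is \<open>C\<^sub>j / g\<close>.
\<close>

lemma block_tuple_dilation:
  assumes "1 \<le> g" and C: "C \<in> sym_tuples g n"
  shows "dilates_to n C (g * n) (scale_tuple (real g) (block_tuple g n C))"
proof -
  define s where "s = 1 / sqrt (real g)"
  have s2: "real g * (s * s) = 1" using assms(1) by (simp add: s_def)
  define V where "V = mat (g * n) n (\<lambda>(p, i). if p mod n = i then s else 0)"
  have V: "V \<in> carrier_mat (g * n) n" by (simp add: V_def)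
  have V_index: "V $$ (k * n + i, a) = s * (if i = a then 1 else 0)" if "k < g" "i < n" "a < n" for k i a
    using that block_index_less[of k g i n] by (simp add: V_def)
  note Ts = block_tuple_sym[OF C]
  have "transpose_mat V * V = 1\<^sub>m n"
  proof (rule mat_eqI_index[of _ n n])
    fix a b assume ab: "a < n" "b < n"
    have "(transpose_mat V * V) $$ (a, b) =
        (\<Sum>k<g. ip n (\<lambda>i. s * (if i = a then 1 else 0)) (\<lambda>i. s * (if i = b then 1 else 0)))"
      unfolding gram_index[OF V ab] ip_def sum_lessThan_mult
      using ab by (intro sum.cong refl) (simp add: V_index)
    also have "\<dots> = real g * (s * s) * (if a = b then 1 else 0)"
      using ab by (simp add: ip_scale_left ip_scale_right ip_unit)
    finally show "(transpose_mat V * V) $$ (a, b) = 1\<^sub>m n $$ (a, b)" using ab s2 by simp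
  qed (use V in auto)
  moreover have "C ! j = transpose_mat V * scale_tuple (real g) (block_tuple g n C) ! j * V"
    if j: "j < g" for j
  proof (rule mat_eqI_index[of _ n n])
    note c = sym_tuples_nth(1)[OF Ts j]
    fix a b assume ab: "a < n" "b < n"
    have col: "ip n (\<lambda>i. V $$ (j * n + i, a)) (mv n M (\<lambda>i. V $$ (j * n + i, b))) =
        ip n (\<lambda>i. s * (if i = a then 1 else 0)) (mv n M (\<lambda>i. s * (if i = b then 1 else 0)))" for M
    proof -
      have "mv n M (\<lambda>i. V $$ (j * n + i, b)) = mv n M (\<lambda>i. s * (if i = b then 1 else 0))"
        by (rule mv_cong) (use j ab in \<open>simp add: V_index\<close>)
      then show ?thesis by (intro ip_cong) (use j ab in \<open>simp_all add: V_index\<close>)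
    qed
    have "(transpose_mat V * scale_tuple (real g) (block_tuple g n C) ! j * V) $$ (a, b) =
        real g * ip (g * n) (\<lambda>r. V $$ (r, a)) (mv (g * n) (entries (block_tuple g n C ! j)) (\<lambda>r. V $$ (r, b)))"
      unfolding scale_tuple_nth[OF Ts j]
      using form_index[of "real g \<cdot>\<^sub>m block_tuple g n C ! j" "g * n" V n a b] c V ab
      by (simp add: ip_mv_smult[OF c] del: index_mult_mat(1))
    also have "\<dots> = real g * (s * s) * C ! j $$ (a, b)"
      using ab by (simp add: block_tuple_form[OF j] col ip_scale_left ip_scale_right mv_scale ip_unit mv_unit)
    finally show "C ! j $$ (a, b) =
        (transpose_mat V * scale_tuple (real g) (block_tuple g n C) ! j * V) $$ (a, b)"
      using s2 by simp
  qed (use V sym_tuples_nth(1)[OF C j] sym_tuples_nth(1)[OF Ts j] in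
      \<open>auto simp: scale_tuple_nth[OF Ts j] intro!: mult_carrier_mat\<close>)
  ultimately show ?thesis
    using V sym_tuples_length[OF C] sym_tuples_length[OF Ts]
    by (auto simp: dilates_to_def scale_tuple_def)
qed

text \<open>
  The linear matrix inequality for the block tuple decouples: its \<open>j\<close>-th block is the inequality for
  \<open>(0, \<dots>, 0, C\<^sub>j, 0, \<dots>, 0)\<close>, which is the hypothesis on coordinate tuples.
\<close>

lemma dilation_estimate_g:
  assumes "1 \<le> g"
  shows "dilation_estimate g (real g)"
  unfolding dilation_estimate_def
proof (intro allI impI ballI)
  fix d n :: nat and A C
  assume A: "A \<in> sym_tuples g d" and cc: "coordinate_closed g (free_spectrahedron d A)"
    and n: "1 \<le> n" and C: "C \<in> free_spectrahedron d A n"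
  have Cs: "C \<in> sym_tuples g n" using C by (simp add: free_spectrahedron_iff[OF A])
  have coord: "(\<Sum>a<d. \<Sum>b<d. A ! j $$ (a, b) * ip n (u a) (mv n (entries (C ! j)) (u b)))
      \<le> (\<Sum>a<d. ip n (u a) (u a))" if j: "j < g" for j u
  proof -
    have "coordinate_tuple g n j (C ! j) \<in> free_spectrahedron d A n"
      using cc C n j by (auto simp: coordinate_closed_def)
    then have "(\<Sum>k<g. \<Sum>a<d. \<Sum>b<d. A ! k $$ (a, b) *
        ip n (u a) (mv n (entries (coordinate_tuple g n j (C ! j) ! k)) (u b)))
        \<le> (\<Sum>a<d. ip n (u a) (u a))"
      by (simp add: free_spectrahedron_iff[OF A])
    moreover have "(\<Sum>k<g. \<Sum>a<d. \<Sum>b<d. A ! k $$ (a, b) *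
        ip n (u a) (mv n (entries (coordinate_tuple g n j (C ! j) ! k)) (u b))) =
        (\<Sum>k<g. if k = j then
          (\<Sum>a<d. \<Sum>b<d. A ! j $$ (a, b) * ip n (u a) (mv n (entries (C ! j)) (u b))) else 0)"
      using j by (intro sum.cong[OF refl]) (simp add: coordinate_tuple_nth ip_mv_zero_mat)
    ultimately show ?thesis using j by simp
  qed
  have "block_tuple g n C \<in> free_spectrahedron d A (g * n)"
    unfolding free_spectrahedron_iff[OF A]
  proof (intro conjI allI block_tuple_sym[OF Cs])
    fix u :: "nat \<Rightarrow> nat \<Rightarrow> real"
    have "(\<Sum>j<g. \<Sum>a<d. \<Sum>b<d. A ! j $$ (a, b) *
        ip (g * n) (u a) (mv (g * n) (entries (block_tuple g n C ! j)) (u b)))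
      \<le> (\<Sum>j<g. \<Sum>a<d. ip n (\<lambda>i. u a (j * n + i)) (\<lambda>i. u a (j * n + i)))"
    proof (rule sum_mono)
      fix j assume "j \<in> {..<g}"
      then have j: "j < g" by simp
      show "(\<Sum>a<d. \<Sum>b<d. A ! j $$ (a, b) *
          ip (g * n) (u a) (mv (g * n) (entries (block_tuple g n C ! j)) (u b)))
        \<le> (\<Sum>a<d. ip n (\<lambda>i. u a (j * n + i)) (\<lambda>i. u a (j * n + i)))"
        using coord[OF j, of "\<lambda>a i. u a (j * n + i)"] by (simp add: block_tuple_form[OF j])
    qed
    also have "\<dots> = (\<Sum>a<d. \<Sum>j<g. ip n (\<lambda>i. u a (j * n + i)) (\<lambda>i. u a (j * n + i)))"
      by (rule sum.swap)
    also have "\<dots> = (\<Sum>a<d. ip (g * n) (u a) (u a))"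
      by (simp add: ip_def sum_lessThan_mult)
    finally show "(\<Sum>j<g. \<Sum>a<d. \<Sum>b<d. A ! j $$ (a, b) *
        ip (g * n) (u a) (mv (g * n) (entries (block_tuple g n C ! j)) (u b)))
      \<le> (\<Sum>a<d. ip (g * n) (u a) (u a))" .
  qed
  then show "\<exists>T\<in>free_spectrahedron d A (g * n). commuting_tuple T \<and>
      dilates_to n C (g * n) (scale_tuple (real g) T)"
    using block_tuple_commuting block_tuple_dilation[OF assms Cs] by blast
qed

section \<open>Sharpness of the dilation constant\<close>

text \<open>
  Diagonal coefficients turn the linear matrix inequality into one scalar-coefficient inequality
  \<open>\<Sum>\<^sub>j c\<^sub>j X\<^sub>j \<preceq> I\<close> for each vector \<open>c\<close> of the list \<open>L\<close>: the set is the maximal matrix convex set over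
  the polyhedron with normals \<open>L\<close>.
\<close>

definition diagonal_tuple :: "nat \<Rightarrow> (nat \<Rightarrow> real) list \<Rightarrow> real mat list" where
  "diagonal_tuple g L =
     map (\<lambda>j. mat (length L) (length L) (\<lambda>(a, b). if a = b then (L ! a) j else 0)) [0..<g]"

lemma diagonal_tuple_sym: "diagonal_tuple g L \<in> sym_tuples g (length L)"
  by (auto simp: sym_tuples_def diagonal_tuple_def intro!: eq_matI)

lemma free_spectrahedron_diagonal_iff:
  "X \<in> free_spectrahedron (length L) (diagonal_tuple g L) n \<longleftrightarrow> X \<in> sym_tuples g n \<and>
    (\<forall>c\<in>set L. \<forall>x. (\<Sum>j<g. c j * qform n (X ! j) x) \<le> ip n x x)"
proof -
  define f where "f c x = (\<Sum>j<g. c j * qform n (X ! j) x)" for c :: "nat \<Rightarrow> real" and x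
  have "(\<Sum>j<g. \<Sum>a<length L. \<Sum>b<length L. diagonal_tuple g L ! j $$ (a, b) *
        ip n (u a) (mv n (entries (X ! j)) (u b))) = (\<Sum>a<length L. f (L ! a) (u a))"
    for u :: "nat \<Rightarrow> nat \<Rightarrow> real"
  proof -
    have "(\<Sum>j<g. \<Sum>a<length L. \<Sum>b<length L. diagonal_tuple g L ! j $$ (a, b) *
        ip n (u a) (mv n (entries (X ! j)) (u b))) =
      (\<Sum>j<g. \<Sum>a<length L. \<Sum>b<length L. if b = a then (L ! a) j * qform n (X ! j) (u a) else 0)"
      by (intro sum.cong refl) (auto simp: diagonal_tuple_def)
    also have "\<dots> = (\<Sum>j<g. \<Sum>a<length L. (L ! a) j * qform n (X ! j) (u a))" by simp
    also have "\<dots> = (\<Sum>a<length L. f (L ! a) (u a))"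
      unfolding f_def by (rule sum.swap)
    finally show ?thesis .
  qed
  moreover have "(\<forall>u :: nat \<Rightarrow> nat \<Rightarrow> real. (\<Sum>a<length L. f (L ! a) (u a)) \<le> (\<Sum>a<length L. ip n (u a) (u a))) \<longleftrightarrow>
      (\<forall>c\<in>set L. \<forall>x. f c x \<le> ip n x x)"
  proof (intro iffI ballI allI)
    fix c x :: "nat \<Rightarrow> real"
    assume *: "\<forall>u :: nat \<Rightarrow> nat \<Rightarrow> real. (\<Sum>a<length L. f (L ! a) (u a)) \<le> (\<Sum>a<length L. ip n (u a) (u a))"
      and "c \<in> set L"
    then obtain k where k: "k < length L" "L ! k = c" by (auto simp: in_set_conv_nth)
    define u where "u a = (if a = k then x else (\<lambda>i. 0))" for a
    have "(\<Sum>a<length L. f (L ! a) (u a)) = (\<Sum>a<length L. if a = k then f c x else 0)"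
      using k by (intro sum.cong refl) (auto simp: u_def f_def ip_def)
    moreover have "(\<Sum>a<length L. ip n (u a) (u a)) = (\<Sum>a<length L. if a = k then ip n x x else 0)"
      by (intro sum.cong refl) (auto simp: u_def ip_def)
    ultimately show "f c x \<le> ip n x x" using *[rule_format, of u] k by simp
  next
    fix u :: "nat \<Rightarrow> nat \<Rightarrow> real"
    assume *: "\<forall>c\<in>set L. \<forall>x. f c x \<le> ip n x x"
    show "(\<Sum>a<length L. f (L ! a) (u a)) \<le> (\<Sum>a<length L. ip n (u a) (u a))"
      using * by (intro sum_mono) simp
  qed
  ultimately show ?thesis
    unfolding free_spectrahedron_iff[OF diagonal_tuple_sym] f_def by simp
qed

lemma bounded_levels_of_forms:
  assumes "0 < r"
    and K: "\<And>n X. X \<in> K n \<Longrightarrow> X \<in> sym_tuples g n"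
    and b: "\<And>n X j x. X \<in> K n \<Longrightarrow> j < g \<Longrightarrow> \<bar>qform n (X ! j) x\<bar> \<le> r * ip n x x"
  shows "bounded_levels K"
  unfolding bounded_levels_def
proof (intro exI[of _ r] allI impI ballI)
  fix n X M and v :: "real vec"
  assume X: "X \<in> K n" and M: "M \<in> set X" and v: "v \<in> carrier_vec n"
  then obtain j where j: "j < g" "M = X ! j"
    using sym_tuples_length[OF K[OF X]] by (auto simp: in_set_conv_nth)
  have c: "M \<in> carrier_mat n n" and sym: "sym_kernel n (entries M)"
    using sym_tuples_nth[OF K[OF X] j(1)] j(2) by auto
  define x where "x = vec_index v"
  define y where "y = mv n (entries M) x"
  \<comment> \<open>The bilinear bound at \<open>y = M x\<close> and \<open>r x\<close>; this scaling balances its right-hand side.\<close>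
  have "2 * ip n y (mv n (entries M) (\<lambda>i. r * x i)) \<le> r * (ip n y y + ip n (\<lambda>i. r * x i) (\<lambda>i. r * x i))"
    using bilinear_bound[OF sym] b[OF X j(1)] j(2) by blast
  then have "r * (2 * ip n y y) \<le> r * (ip n y y + r * (r * ip n x x))"
    by (simp add: ip_mv_linear y_def[symmetric] algebra_simps)
  then have "ip n y y \<le> (r * r) * ip n x x" using assms(1) by simp
  then have "sqrt (ip n y y) \<le> r * sqrt (ip n x x)"
    using assms(1) by (metis real_sqrt_le_mono real_sqrt_mult real_sqrt_mult_self abs_of_pos)
  moreover have "(M *\<^sub>v v) \<bullet> (M *\<^sub>v v) = ip n y y"
    using c v by (auto simp: scalar_prod_def ip_def y_def mv_def x_def atLeast0LessThan intro!: sum.cong)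
  moreover have "v \<bullet> v = ip n x x"
    using v by (simp add: scalar_prod_def ip_def x_def atLeast0LessThan)
  ultimately show "sqrt ((M *\<^sub>v v) \<bullet> (M *\<^sub>v v)) \<le> r * sqrt (v \<bullet> v)" by simp
qed

lemma coordinate_sum:
  assumes "j < g"
  shows "(\<Sum>k<g. c k * qform n (coordinate_tuple g n j M ! k) x) = c j * qform n M x"
proof -
  have "(\<Sum>k<g. c k * qform n (coordinate_tuple g n j M ! k) x) =
      (\<Sum>k<g. if k = j then c j * qform n M x else 0)"
    using assms by (intro sum.cong refl) (simp add: coordinate_tuple_nth ip_mv_zero_mat)
  then show ?thesis using assms by simp
qed

lemma diagonal_coordinate_closed:
  assumes "\<And>c j n X x. c \<in> set L \<Longrightarrow> j < g \<Longrightarrow> X \<in> free_spectrahedron (length L) (diagonal_tuple g L) n \<Longrightarrow>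
    c j * qform n (X ! j) x \<le> ip n x x"
  shows "coordinate_closed g (free_spectrahedron (length L) (diagonal_tuple g L))"
  unfolding coordinate_closed_def
proof (intro allI impI ballI)
  fix n C j assume C: "C \<in> free_spectrahedron (length L) (diagonal_tuple g L) n" and j: "j < g"
  then have "C \<in> sym_tuples g n" by (simp add: free_spectrahedron_diagonal_iff)
  then have "coordinate_tuple g n j (C ! j) \<in> sym_tuples g n"
    using coordinate_tuple_sym sym_tuples_nth j by blast
  then show "coordinate_tuple g n j (C ! j) \<in> free_spectrahedron (length L) (diagonal_tuple g L) n"
    unfolding free_spectrahedron_diagonal_iff using assms[OF _ j C] by (simp add: coordinate_sum[OF j])
qed

text \<open>
  In a set with \<open>X \<mapsto> -X\<close> as a symmetry, \<open>C\<close> dilates to \<open>(-g) (-T)\<close>, so a counterexample for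
  \<open>\<rho> \<le> -g\<close> must be asymmetric. The box \<open>-1 \<le> X\<^sub>j \<le> K\<close> with \<open>K = 1 - \<rho>\<close> works: it contains the scalar point \<open>(K, 0, \<dots>, 0)\<close>, while a compression of \<open>\<rho> T\<^sub>1\<close>
  with \<open>T\<^sub>1 \<ge> -1\<close> and \<open>\<rho> \<le> 0\<close> is at most \<open>-\<rho> < K\<close>.
\<close>

lemma not_dilation_estimate_nonpos:
  assumes "1 \<le> g" "\<rho> \<le> 0"
  shows "\<not> dilation_estimate g \<rho>"
proof
  assume est: "dilation_estimate g \<rho>"
  define K where "K = 1 - \<rho>"
  have K: "1 \<le> K" using assms(2) by (simp add: K_def)
  define e where "e j t k = (if k = j then t else 0)" for j k :: nat and t :: real
  define L where "L = map (\<lambda>j. e j (- 1)) [0..<g] @ map (\<lambda>j. e j (1 / K)) [0..<g]"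
  let ?D = "free_spectrahedron (length L) (diagonal_tuple g L)"
  have box: "X \<in> ?D n \<longleftrightarrow> X \<in> sym_tuples g n \<and>
      (\<forall>j<g. \<forall>x. - ip n x x \<le> qform n (X ! j) x \<and> qform n (X ! j) x \<le> K * ip n x x)" for X n
  proof -
    have "(\<Sum>k<g. e j t k * qform n (X ! k) x) = t * qform n (X ! j) x" if "j < g" for j t x
      unfolding e_def using that by (rule sum_mult_delta(2))
    then have "(\<forall>c\<in>set L. \<forall>x. (\<Sum>j<g. c j * qform n (X ! j) x) \<le> ip n x x) \<longleftrightarrow>
        (\<forall>j<g. \<forall>x. - 1 * qform n (X ! j) x \<le> ip n x x) \<and> (\<forall>j<g. \<forall>x. 1 / K * qform n (X ! j) x \<le> ip n x x)"
      by (simp add: L_def ball_Un) (simp add: Ball_def)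
    also have "\<dots> \<longleftrightarrow> (\<forall>j<g. \<forall>x. - ip n x x \<le> qform n (X ! j) x \<and> qform n (X ! j) x \<le> K * ip n x x)"
    proof -
      have "- 1 * q \<le> s \<longleftrightarrow> - s \<le> q" "1 / K * q \<le> s \<longleftrightarrow> q \<le> K * s" for q s :: real
        using K by (auto simp: field_simps)
      then show ?thesis by (simp only:) blast
    qed
    finally show ?thesis by (simp only: free_spectrahedron_diagonal_iff)
  qed
  have "bounded_levels ?D"
  proof (rule bounded_levels_of_forms)
    fix n X j x assume X: "X \<in> ?D n" and j: "j < g"
    have "ip n x x \<le> K * ip n x x"
      using mult_right_mono[OF K ip_self_nonneg[of n x]] by simp
    moreover have "- ip n x x \<le> qform n (X ! j) x" "qform n (X ! j) x \<le> K * ip n x x"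
      using X j by (simp_all add: box)
    ultimately show "\<bar>qform n (X ! j) x\<bar> \<le> K * ip n x x" by linarith
  qed (use K box in auto)
  moreover have "coordinate_closed g ?D"
  proof (rule diagonal_coordinate_closed)
    fix c j n X x assume c: "c \<in> set L" and j: "j < g" and X: "X \<in> ?D n"
    have "c j \<in> {0, - 1, 1 / K}" using c by (auto simp: L_def e_def split: if_splits)
    moreover have "- ip n x x \<le> qform n (X ! j) x" "qform n (X ! j) x \<le> K * ip n x x"
      using X j by (simp_all add: box)
    moreover have "1 / K * qform n (X ! j) x \<le> 1 / K * (K * ip n x x)"
      using K calculation(3) by (intro mult_left_mono) simp_all
    ultimately show "c j * qform n (X ! j) x \<le> ip n x x"
      using K ip_self_nonneg[of n x] by auto
  qed
  moreover define C where "C = coordinate_tuple g 1 0 (K \<cdot>\<^sub>m 1\<^sub>m 1)"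
  have Cs: "C \<in> sym_tuples g 1"
    unfolding C_def by (rule coordinate_tuple_sym) (auto simp: transpose_smult_mat)
  have "C \<in> ?D 1"
    unfolding box
  proof (intro conjI Cs allI impI)
    fix j x assume "j < g"
    then have "qform 1 (C ! j) x = (if j = 0 then K else 0) * ip 1 x x"
      by (simp add: C_def coordinate_tuple_nth ip_def mv_def)
    then have "qform 1 (C ! j) x = K * ip 1 x x \<or> qform 1 (C ! j) x = 0" by (simp split: if_splits)
    moreover have "0 \<le> ip 1 x x" "0 \<le> K * ip 1 x x"
      using K ip_self_nonneg[of 1 x] by (auto intro!: mult_nonneg_nonneg)
    ultimately show "- ip 1 x x \<le> qform 1 (C ! j) x" "qform 1 (C ! j) x \<le> K * ip 1 x x"
      by linarith+
  qed
  moreover have "1 \<le> length L" using assms(1) by (simp add: L_def)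
  ultimately obtain T where T: "T \<in> ?D (g * 1)" "dilates_to 1 C (g * 1) (scale_tuple \<rho> T)"
    using est diagonal_tuple_sym[of g L] unfolding dilation_estimate_def by blast
  have Ts: "T \<in> sym_tuples g (g * 1)" using T(1) by (simp add: box)
  obtain u where u: "\<And>a. a < 1 \<Longrightarrow> ip (g * 1) (u a) (u a) = 1"
    "\<And>j a b. j < g \<Longrightarrow> a < 1 \<Longrightarrow> b < 1 \<Longrightarrow>
      C ! j $$ (a, b) = \<rho> * ip (g * 1) (u a) (mv (g * 1) (entries (T ! j)) (u b))"
    using dilates_to_forms[OF Ts T(2) sym_tuples_length[OF Cs]] by blast
  have "- 1 \<le> qform (g * 1) (T ! 0) (u 0)"
    using T(1)[unfolded box, THEN conjunct2, rule_format, of 0 "u 0"] u(1)[of 0] assms(1) by simp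
  then have "\<rho> * qform (g * 1) (T ! 0) (u 0) \<le> \<rho> * - 1"
    using assms(2) by (rule mult_left_mono_neg)
  moreover have "\<rho> * qform (g * 1) (T ! 0) (u 0) = K"
    using u(2)[of 0 0 0] assms(1) by (simp add: C_def coordinate_tuple_nth)
  ultimately show False by (simp add: K_def)
qed

text \<open>
  Points of the grid \<open>\<int>\<^sup>g / N\<close> in the closed unit ball. The members are functions on all of \<open>nat\<close>;
  extensionality of the numerators outside \<open>{..<g}\<close> makes the set finite.
\<close>

definition ball_grid :: "nat \<Rightarrow> nat \<Rightarrow> (nat \<Rightarrow> real) set" where
  "ball_grid g N = (\<lambda>m j. real_of_int (m j) / real N) `
     {m \<in> {..<g} \<rightarrow>\<^sub>E {- int N..int N}. (\<Sum>j<g. m j * m j) \<le> int N * int N}"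

lemma finite_ball_grid: "finite (ball_grid g N)"
proof -
  have "finite ({..<g} \<rightarrow>\<^sub>E {- int N..int N})" by (intro finite_PiE) auto
  then show ?thesis by (simp add: ball_grid_def)
qed

lemma ball_gridI:
  assumes "1 \<le> N" "(\<Sum>j<g. m j * m j) \<le> int N * int N"
  shows "\<exists>c\<in>ball_grid g N. \<forall>j<g. c j = real_of_int (m j) / real N"
proof
  have "\<bar>m j\<bar> \<le> int N" if "j < g" for j
  proof -
    have "m j * m j \<le> (\<Sum>j<g. m j * m j)"
      using that by (intro member_le_sum) auto
    then have "(m j)\<^sup>2 \<le> (int N)\<^sup>2" using assms(2) by (simp add: power2_eq_square)
    then show ?thesis using abs_le_square_iff[of "m j" "int N"] by simp
  qed
  then have "restrict m {..<g} \<in> {..<g} \<rightarrow>\<^sub>E {- int N..int N}" by (auto simp: abs_le_iff minus_le_iff)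
  then show "(\<lambda>j. real_of_int (restrict m {..<g} j) / real N) \<in> ball_grid g N"
    unfolding ball_grid_def using assms(2) by (intro imageI CollectI conjI) (assumption, simp)
qed simp

lemma ball_grid_norm:
  assumes "c \<in> ball_grid g N"
  shows "(\<Sum>j<g. c j * c j) \<le> 1"
proof -
  obtain m where m: "(\<Sum>j<g. m j * m j) \<le> int N * int N" "\<And>j. c j = real_of_int (m j) / real N"
    using assms by (auto simp: ball_grid_def)
  have "(\<Sum>j<g. real_of_int (m j) * real_of_int (m j)) = real_of_int (\<Sum>j<g. m j * m j)" by simp
  also have "\<dots> \<le> real_of_int (int N * int N)" using m(1) by (simp only: of_int_le_iff)
  also have "\<dots> = real N * real N" by simp
  finally have "(\<Sum>j<g. real_of_int (m j) * real_of_int (m j)) / (real N * real N) \<le> 1"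
    by (cases "N = 0") simp_all
  then show ?thesis by (simp add: m(2) sum_divide_distrib)
qed

text \<open>
  Rounding towards \<open>0\<close>: the first bound keeps a rounded point of the ball inside the ball.
\<close>

lemma integer_truncation:
  fixes t :: real
  shows "\<exists>k::int. \<bar>real_of_int k\<bar> \<le> \<bar>t\<bar> \<and> t * t - \<bar>t\<bar> \<le> real_of_int k * t"
proof (cases "0 \<le> t")
  case True
  have "(t - 1) * t \<le> real_of_int \<lfloor>t\<rfloor> * t" using True by (intro mult_right_mono) linarith+
  then show ?thesis using True by (intro exI[of _ "\<lfloor>t\<rfloor>"]) (auto simp: algebra_simps)
next
  case False
  have "(- t - 1) * (- t) \<le> real_of_int \<lfloor>- t\<rfloor> * (- t)" using False by (intro mult_right_mono) linarith+
  moreover have "0 \<le> \<lfloor>- t\<rfloor>" "real_of_int \<lfloor>- t\<rfloor> \<le> - t" using False by auto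
  ultimately show ?thesis using False by (intro exI[of _ "- \<lfloor>- t\<rfloor>"]) (auto simp: algebra_simps)
qed

text \<open>
  For large \<open>N\<close> the polytope with normals in the grid is only slightly larger than the unit ball. For \<open>\<mu>\<close> of length
  \<open>r\<close>, rounding \<open>\<mu> / r\<close> to the grid gives a normal \<open>c\<close> that is off by at most \<open>1 / N\<close> in each coordinate,
  so \<open>1 \<ge> \<Sum>\<^sub>j c\<^sub>j \<mu>\<^sub>j \<ge> r - g r / N\<close>.
\<close>

lemma ball_grid_polar:
  assumes N: "1 \<le> N" and polar: "\<And>c. c \<in> ball_grid g N \<Longrightarrow> (\<Sum>j<g. c j * \<mu> j) \<le> 1"
  shows "sqrt (\<Sum>j<g. \<mu> j * \<mu> j) * (real N - real g) \<le> real N"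
proof -
  define r where "r = sqrt (\<Sum>j<g. \<mu> j * \<mu> j)"
  have r2: "r * r = (\<Sum>j<g. \<mu> j * \<mu> j)" by (simp add: r_def sum_nonneg)
  show ?thesis
  proof (cases "r = 0")
    case True
    then show ?thesis by (simp add: r_def[symmetric])
  next
    case False
    then have r: "0 < r" by (simp add: r_def sum_nonneg less_le)
    define t where "t j = real N * \<mu> j / r" for j
    have "\<forall>j. \<exists>k::int. \<bar>real_of_int k\<bar> \<le> \<bar>t j\<bar> \<and> t j * t j - \<bar>t j\<bar> \<le> real_of_int k * t j"
      using integer_truncation by blast
    then obtain k :: "nat \<Rightarrow> int" where k: "\<And>j. \<bar>real_of_int (k j)\<bar> \<le> \<bar>t j\<bar>"
      "\<And>j. t j * t j - \<bar>t j\<bar> \<le> real_of_int (k j) * t j"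
      by metis
    have "(\<Sum>j<g. real_of_int (k j) * real_of_int (k j)) \<le> (\<Sum>j<g. t j * t j)"
    proof (rule sum_mono)
      fix j
      show "real_of_int (k j) * real_of_int (k j) \<le> t j * t j"
        using k(1)[of j] abs_le_square_iff[of "real_of_int (k j)" "t j"] by (simp add: power2_eq_square)
    qed
    also have "\<dots> = (real N * real N) * ((\<Sum>j<g. \<mu> j * \<mu> j) / (r * r))"
      by (simp add: t_def sum_distrib_left sum_divide_distrib algebra_simps)
    also have "\<dots> = real N * real N" using r by (simp add: r2[symmetric])
    finally have "real_of_int (\<Sum>j<g. k j * k j) \<le> real_of_int (int N * int N)" by simp
    then have "(\<Sum>j<g. k j * k j) \<le> int N * int N" by (simp only: of_int_le_iff)
    then obtain c where c: "c \<in> ball_grid g N" "\<And>j. j < g \<Longrightarrow> c j = real_of_int (k j) / real N"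
      using ball_gridI[OF N] by blast
    have "(\<Sum>j<g. real N * (\<mu> j * \<mu> j) / r - r) \<le> (\<Sum>j<g. real N * (c j * \<mu> j))"
    proof (rule sum_mono)
      fix j assume j: "j \<in> {..<g}"
      have "\<mu> j * \<mu> j \<le> r * r"
        unfolding r2 using j by (intro member_le_sum) auto
      then have mu: "\<bar>\<mu> j\<bar> \<le> r"
        using r abs_le_square_iff[of "\<mu> j" r] by (simp add: power2_eq_square)
      have "(t j * t j - \<bar>t j\<bar>) * (r / real N) \<le> real_of_int (k j) * t j * (r / real N)"
        using r by (intro mult_right_mono k(2)) simp
      moreover have "(t j * t j - \<bar>t j\<bar>) * (r / real N) = real N * (\<mu> j * \<mu> j) / r - \<bar>\<mu> j\<bar>"
        using r N by (simp add: t_def abs_mult field_simps)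
      moreover have "real_of_int (k j) * t j * (r / real N) = real N * (c j * \<mu> j)"
        using r N j by (simp add: t_def c(2))
      ultimately show "real N * (\<mu> j * \<mu> j) / r - r \<le> real N * (c j * \<mu> j)"
        using mu by linarith
    qed
    also have "\<dots> = real N * (\<Sum>j<g. c j * \<mu> j)" by (simp add: sum_distrib_left)
    also have "\<dots> \<le> real N * 1" by (intro mult_left_mono polar c) simp
    also have "(\<Sum>j<g. real N * (\<mu> j * \<mu> j) / r - r) = real N * (r * r) / r - real g * r"
      unfolding r2 by (simp add: sum_subtractf sum_distrib_left sum_divide_distrib)
    also have "\<dots> = r * (real N - real g)" using r by (simp add: algebra_simps)
    finally show ?thesis by (simp add: r_def)
  qed
qed

text \<open>
  Let the normals form a fine grid in the unit ball. The spin tuple satisfies all inequalities, as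
  \<open>\<Sum>\<^sub>j c\<^sub>j P\<^sub>j \<preceq> |c| I\<close>. A commuting tuple \<open>T\<close> satisfying them has its joint spectrum in the polytope, hence in
  the ball of radius \<open>R\<close> close to \<open>1\<close>, and therefore \<open>\<Sum>\<^sub>j P\<^sub>j \<otimes> T\<^sub>j \<preceq> R\<close>. If \<open>P\<close> dilates to \<open>\<rho> T\<close>, compressing
  this inequality and evaluating it at \<open>\<Sum>\<^sub>a e\<^sub>a \<otimes> e\<^sub>a\<close> yields \<open>g \<le> \<rho> R\<close>.
\<close>

lemma not_dilation_estimate_pos:
  assumes "0 < \<rho>" "\<rho> < real g"
  shows "\<not> dilation_estimate g \<rho>"
proof
  assume est: "dilation_estimate g \<rho>"
  \<comment> \<open>Any radius strictly between \<open>1\<close> and \<open>g / \<rho>\<close> would do.\<close>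
  define R where "R = (1 + real g / \<rho>) / 2"
  have "1 < real g / \<rho>" using assms by simp
  then have R: "1 < R" "\<rho> * R < real g" using assms by (auto simp: R_def field_simps)
  \<comment> \<open>This \<open>N\<close> makes \<open>N / (N - g)\<close>, the radius of a ball around the polytope, at most \<open>R\<close>.\<close>
  obtain N :: nat where N: "real g * R / (R - 1) < real N" using reals_Archimedean2 by blast
  have "0 \<le> real g * R / (R - 1)" using R by simp
  then have N1: "1 \<le> N" using N by (cases N) auto
  have NR: "real N \<le> R * (real N - real g)" using N R(1) by (simp add: field_simps)
  obtain L where L: "set L = ball_grid g N" using finite_list[OF finite_ball_grid] by blast
  let ?D = "free_spectrahedron (length L) (diagonal_tuple g L)"
  have contraction: "\<bar>qform n (X ! j) x\<bar> \<le> 1 * ip n x x" if X: "X \<in> ?D n" and j: "j < g" for n X j x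
  proof -
    have "t * qform n (X ! j) x \<le> ip n x x" if "t = 1 \<or> t = - 1" for t
    proof -
      define s :: int where "s = (if t = 1 then 1 else - 1)"
      have s: "real_of_int s = t" "s * s = 1" using that by (auto simp: s_def)
      have "(\<Sum>k<g. (if k = j then int N * s else 0) * (if k = j then int N * s else 0)) =
          (\<Sum>k<g. if k = j then int N * int N * (s * s) else 0)"
        by (intro sum.cong) auto
      then have "(\<Sum>k<g. (if k = j then int N * s else 0) * (if k = j then int N * s else 0)) \<le> int N * int N"
        using s(2) j by simp
      from ball_gridI[OF N1 this] obtain c where c: "c \<in> ball_grid g N"
        "\<And>k. k < g \<Longrightarrow> c k = (if k = j then t else 0)"
        using N1 s(1) by fastforce
      have "t * qform n (X ! j) x = (\<Sum>k<g. (if k = j then t else 0) * qform n (X ! k) x)"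
        using j by (simp only: sum_mult_delta(2)[of j g t "\<lambda>k. qform n (X ! k) x"])
      also have "\<dots> = (\<Sum>k<g. c k * qform n (X ! k) x)" by (intro sum.cong refl) (simp add: c(2))
      also have "\<dots> \<le> ip n x x" using X c(1) L by (simp add: free_spectrahedron_diagonal_iff)
      finally show ?thesis .
    qed
    from this[of 1] this[of "- 1"] show ?thesis by simp
  qed
  have "bounded_levels ?D"
    by (rule bounded_levels_of_forms[of 1 _ g], simp, simp add: free_spectrahedron_diagonal_iff,
        rule contraction)
  moreover have "coordinate_closed g ?D"
  proof (rule diagonal_coordinate_closed)
    fix c j n X x assume c: "c \<in> set L" and j: "j < g" and X: "X \<in> ?D n"
    have "c j * c j \<le> (\<Sum>j<g. c j * c j)" using j by (intro member_le_sum) auto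
    also have "\<dots> \<le> 1" using c L by (auto intro: ball_grid_norm)
    finally have "\<bar>c j\<bar> \<le> 1" using abs_le_square_iff[of "c j" 1] by (simp add: power2_eq_square)
    then have "\<bar>c j\<bar> * \<bar>qform n (X ! j) x\<bar> \<le> 1 * (1 * ip n x x)"
      by (intro mult_mono contraction[OF X j]) auto
    then show "c j * qform n (X ! j) x \<le> ip n x x"
      by (metis abs_le_D1 abs_mult mult_1)
  qed
  moreover define d :: nat where "d = 2 ^ (g - 1)"
  have d: "1 \<le> d" by (simp add: d_def)
  define P where "P = spin_tuple g"
  have Ps: "P \<in> sym_tuples g d" using spin_tuple_sym by (simp add: P_def d_def)
  have clifford: "clifford_kernels g d (\<lambda>j. entries (P ! j))"
    using clifford_spin_tuple by (simp add: P_def d_def)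
  have "P \<in> ?D d"
    unfolding free_spectrahedron_diagonal_iff L
    using Ps clifford_linear_bound[OF clifford ball_grid_norm] by blast
  moreover have "1 \<le> length L"
    using ball_gridI[OF N1, of "\<lambda>j. 0" g] L by (cases L) auto
  ultimately obtain T where T: "T \<in> ?D (g * d)" "commuting_tuple T"
    "dilates_to d P (g * d) (scale_tuple \<rho> T)"
    using est diagonal_tuple_sym[of g L] d unfolding dilation_estimate_def by blast
  define M where "M = g * d"
  note T = T[folded M_def]
  have Ts: "T \<in> sym_tuples g M" using T(1) by (simp add: free_spectrahedron_diagonal_iff)
  obtain u where u: "\<And>a. a < d \<Longrightarrow> ip M (u a) (u a) = 1"
    "\<And>j a b. j < g \<Longrightarrow> a < d \<Longrightarrow> b < d \<Longrightarrow> P ! j $$ (a, b) = \<rho> * ip M (u a) (mv M (entries (T ! j)) (u b))"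
    using dilates_to_forms[OF Ts T(3) sym_tuples_length[OF Ps]] by blast
  have "(\<Sum>j<g. ip M (mv M (entries (T ! j)) w) (mv M (entries (T ! j)) w)) \<le> (R * R) * ip M w w" for w
  proof (rule sum_squares_bound)
    fix v \<mu> assume v: "ip M v v \<noteq> 0" "\<forall>j<g. \<forall>i<M. mv M (entries (T ! j)) v i = \<mu> j * v i"
    have "qform M (T ! j) v = \<mu> j * ip M v v" if "j < g" for j
      unfolding ip_scale_right[symmetric] using v(2) that by (intro ip_cong) auto
    then have "(\<Sum>j<g. c j * \<mu> j) * ip M v v = (\<Sum>j<g. c j * qform M (T ! j) v)" for c
      by (simp add: sum_distrib_right mult.assoc)
    moreover have "(\<Sum>j<g. c j * qform M (T ! j) v) \<le> ip M v v" if "c \<in> ball_grid g N" for c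
      using T(1) that L by (simp add: free_spectrahedron_diagonal_iff)
    ultimately have "(\<Sum>j<g. c j * \<mu> j) * ip M v v \<le> 1 * ip M v v" if "c \<in> ball_grid g N" for c
      using that by simp
    moreover have "0 < ip M v v" using v(1) ip_self_nonneg[of M v] by simp
    ultimately have "(\<Sum>j<g. c j * \<mu> j) \<le> 1" if "c \<in> ball_grid g N" for c
      using that by (simp only: mult_le_cancel_right_pos)
    then have "sqrt (\<Sum>j<g. \<mu> j * \<mu> j) * (real N - real g) \<le> R * (real N - real g)"
      using order_trans[OF ball_grid_polar[OF N1, of g \<mu>] NR] by blast
    moreover have "0 < real N - real g"
    proof (rule ccontr)
      assume "\<not> 0 < real N - real g"
      then have "R * (real N - real g) \<le> 0" using R(1) by (intro mult_nonneg_nonpos) simp_all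
      then show False using NR N1 by simp
    qed
    ultimately have "sqrt (\<Sum>j<g. \<mu> j * \<mu> j) \<le> R" by (simp add: mult_le_cancel_right)
    then show "(\<Sum>j<g. \<mu> j * \<mu> j) \<le> R * R"
      using sqrt_le_D by (fastforce simp: power2_eq_square)
  qed (use sym_tuples_nth(3)[OF Ts] commuting_tuple_commute_on[OF Ts T(2)] in auto)
  then have "(\<Sum>j<g. \<Sum>a<d. \<Sum>b<d. P ! j $$ (a, b) * ip M (u a) (mv M (entries (T ! j)) (u b)))
      \<le> R * (\<Sum>a<d. ip M (u a) (u a))"
    using R(1) sym_tuples_nth(3)[OF Ts] commuting_tuple_commute_on[OF Ts T(2)]
    by (intro commuting_spin_inequality[OF clifford]) auto
  also have "\<dots> = R * real d" by (simp add: u(1))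
  finally have "\<rho> * (\<Sum>j<g. \<Sum>a<d. \<Sum>b<d. P ! j $$ (a, b) * ip M (u a) (mv M (entries (T ! j)) (u b)))
      \<le> \<rho> * (R * real d)"
    using assms(1) by simp
  moreover have "\<rho> * (\<Sum>j<g. \<Sum>a<d. \<Sum>b<d. P ! j $$ (a, b) * ip M (u a) (mv M (entries (T ! j)) (u b))) =
      (\<Sum>j<g. \<Sum>a<d. \<Sum>b<d. P ! j $$ (a, b) * P ! j $$ (a, b))"
    unfolding sum_distrib_left by (intro sum.cong refl) (simp add: u(2))
  moreover have "\<dots> = real g * real d"
    using clifford_square_trace[OF clifford] by simp
  ultimately have "real g * real d \<le> (\<rho> * R) * real d" by (simp add: mult.assoc)
  then show False using R(2) d by simp
qed

theorem corollary14p11: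
  fixes g :: nat
  assumes "2 \<le> g"
  shows "levelwise_subset (min_ball g) (scaled (real g) (spin_ball g)) \<and>
    (\<forall>\<rho> \<ge> 0. levelwise_subset (min_ball g) (scaled \<rho> (spin_ball g)) \<longrightarrow> real g \<le> \<rho>) \<and>
    dilation_estimate g (real g) \<and>
    (\<forall>\<rho> < real g. \<not> dilation_estimate g \<rho>)"
proof (intro conjI allI impI)
  have g: "1 \<le> g" using assms by simp
  show "levelwise_subset (min_ball g) (scaled (real g) (spin_ball g))"
    using g by (rule min_ball_subset_spin_ball)
  show "dilation_estimate g (real g)" using g by (rule dilation_estimate_g)
  show "real g \<le> \<rho>" if "0 \<le> \<rho>" "levelwise_subset (min_ball g) (scaled \<rho> (spin_ball g))" for \<rho>
    using that by (rule min_ball_subset_spin_ball_sharp)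
  show "\<not> dilation_estimate g \<rho>" if "\<rho> < real g" for \<rho>
    using not_dilation_estimate_nonpos[OF g, of \<rho>] not_dilation_estimate_pos[of \<rho> g] that by linarith
qed

end
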